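(* Consider the party version of Phragmén's election method with two parties $A$ and $B$, and let the proportions of votes on $A$, $B$ and $AB$ be $\alpha,\beta\ge 0$ and $\zeta=1-\alpha-\beta\ge0$, respectively. Assume that $\alpha+\beta>0$. Let $n_A$ and $n_B$ be the numbers of seats given to the two parties when $n$ seats have been distributed (ties being broken in an arbitrary way). Then the fractions $n_A/n$ and $n_B/n$ converge to some limits $p_A$ and $p_B=1-p_A$, respectively, as $n\to\infty$. Furthermore, the following holds. (i) $n_A=p_An+O(1)$ and $n_B=p_Bn+O(1)$ as $n\to\infty$. (ii) If $\alpha\ge\beta>0$, then $$p_B=\frac{1}{2+b_0+\rho},$$ where $\rho=\rho(a,b)$ is the rotation number of the dynamical system $f_\pm(x)=\{\,\{ax+b\},\{ax+b\}_+\}$ with $$a:=\frac{\alpha\beta}{(\alpha+\zeta)(\beta+\zeta)}=\frac{\alpha\beta}{(1-\alpha)(1-\beta)}\in(0,1],\qquad b^*:=\frac{\alpha-\beta}{\beta}+\frac{\alpha(1-\alpha-\beta)}{(1-\alpha)(1-\beta)},$$ $$b:=b^*-\lfloor b^*\rfloor,\qquad b_0:=\lfloor b^*\rfloor .$$ Moreover, $a<1$ if and only if $\zeta>0$. (iii) If $\alpha\ge\beta>0$, the rotation number $\rho$ in (ii) is rational, and furthermore $\zeta>0$, then the sequence of awarded seats (the infinite sequence of letters $A$, $B$ listing which party gets each successive seat) is eventually periodic.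
   Context: Phragmén's method, party version, two parties $A,B$: there are three types of ballots, $A$, $B$ and $AB$ (the latter voting for both parties), with vote proportions $v_A=\alpha$, $v_B=\beta$, $v_{AB}=\zeta$. Each ballot type $\sigma\in\{A,B,AB\}$ has a free voting power $x_\sigma\ge0$; initially all $x_\sigma=0$. Seats are awarded one at a time. For each seat, define $\Delta_A,\Delta_B$ by $$\alpha(x_A+\Delta_A)+\zeta(x_{AB}+\Delta_A)=1,\qquad \beta(x_B+\Delta_B)+\zeta(x_{AB}+\Delta_B)=1$$ (a party that appears on no ballot is ignored, i.e. its $\Delta$ is $+\infty$). The seat goes to the party $i^*\in\{A,B\}$ with the smallest $\Delta_{i^*}$; if $\Delta_A=\Delta_B$ there is a tie and either party may be chosen. Then the free voting powers are updated: $x_\sigma$ is replaced by $0$ for each ballot type $\sigma$ containing $i^*$, and by $x_\sigma+\Delta_{i^*}$ for each ballot type not containing $i^*$. A party may receive arbitrarily many seats. Fractional parts: $\{x\}:=x-\lfloor x\rfloor\in[0,1)$ and $\{x\}_+:=1-\{-x\}\in(0,1]$ (so $\{x\}_+=1$ when $x$ is an integer). Rotation number: for $0<a\le 1$ and $0\le b<1$, let $F_-(x):=ax+b+(1-a)\lfloor x\rfloor$ and $F_+(x):=ax+b-(1-a)\lfloor 1-x\rfloor$ for $x\in\mathbb R$. The rotation number $\rho=\rho(a,b)\in[0,1)$ of $f_\pm$ is the number such that $F_-^n(x)/n\to\rho$ and $F_+^n(x)/n\to\rho$ as $n\to\infty$ for every $x\in\mathbb R$ (the limits exist, coincide and do not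 depend on $x$; for $a=1$ one has $\rho=b$). *)

theory Defs
  imports "HOL-Analysis.Analysis" "HOL-Library.Landau_Symbols"
begin

section \<open>Phragmen's method, party version, with two parties\<close>

datatype party = PartyA | PartyB

datatype ballot = BallotA | BallotB | BallotAB

fun approves :: "ballot \<Rightarrow> party set" where
  "approves BallotA = {PartyA}"
| "approves BallotB = {PartyB}"
| "approves BallotAB = {PartyA, PartyB}"

fun votes :: "real \<Rightarrow> real \<Rightarrow> real \<Rightarrow> ballot \<Rightarrow> real" where
  "votes \<alpha> \<beta> \<zeta> BallotA = \<alpha>"
| "votes \<alpha> \<beta> \<zeta> BallotB = \<beta>"
| "votes \<alpha> \<beta> \<zeta> BallotAB = \<zeta>"

definition on_some_ballot :: "(ballot \<Rightarrow> real) \<Rightarrow> party \<Rightarrow> bool" where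
  "on_some_ballot v i \<longleftrightarrow> (\<exists>\<sigma>. i \<in> approves \<sigma> \<and> v \<sigma> > 0)"

text \<open>The amount by which the free voting powers \<open>x\<close> have to grow before the supporters of
  \<open>i\<close> have total voting power 1. A party that appears on no ballot is ignored, which is
  encoded by the value infinity.\<close>

definition Delta :: "(ballot \<Rightarrow> real) \<Rightarrow> (ballot \<Rightarrow> real) \<Rightarrow> party \<Rightarrow> ereal" where
  "Delta v x i =
     (if on_some_ballot v i
      then ereal (THE d. (\<Sum>\<sigma> | i \<in> approves \<sigma>. v \<sigma> * (x \<sigma> + d)) = 1)
      else \<infinity>)"

definition award :: "(ballot \<Rightarrow> real) \<Rightarrow> party \<Rightarrow> (ballot \<Rightarrow> real) \<Rightarrow> ballot \<Rightarrow> real" where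
  "award v i x \<sigma> = (if i \<in> approves \<sigma> then 0 else x \<sigma> + real_of_ereal (Delta v x i))"

text \<open>Seats are numbered from 0: \<open>w n\<close> is the party receiving the seat awarded when \<open>n\<close> seats
  have already been distributed, and \<open>voting_power v w n\<close> are the free voting powers at that
  moment.\<close>

primrec voting_power :: "(ballot \<Rightarrow> real) \<Rightarrow> (nat \<Rightarrow> party) \<Rightarrow> nat \<Rightarrow> ballot \<Rightarrow> real" where
  "voting_power v w 0 = (\<lambda>_. 0)"
| "voting_power v w (Suc n) = award v (w n) (voting_power v w n)"

text \<open>The sequences of seats that the method can produce. The inequality is not strict, so
  that ties may be broken in any way, independently at each seat.\<close>

definition phragmen_seats :: "(ballot \<Rightarrow> real) \<Rightarrow> (nat \<Rightarrow> party) \<Rightarrow> bool" where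
  "phragmen_seats v w \<longleftrightarrow>
     (\<forall>n i. Delta v (voting_power v w n) (w n) \<le> Delta v (voting_power v w n) i)"

definition seats :: "(nat \<Rightarrow> party) \<Rightarrow> party \<Rightarrow> nat \<Rightarrow> nat" where
  "seats w i n = card {k. k < n \<and> w k = i}"

definition eventually_periodic :: "(nat \<Rightarrow> 'a) \<Rightarrow> bool" where
  "eventually_periodic w \<longleftrightarrow> (\<exists>N p. p > 0 \<and> (\<forall>n\<ge>N. w (n + p) = w n))"

lemma supporting_ballots:
  "{\<sigma>. PartyA \<in> approves \<sigma>} = {BallotA, BallotAB}"
  "{\<sigma>. PartyB \<in> approves \<sigma>} = {BallotB, BallotAB}"
proof -
  have "PartyA \<in> approves \<sigma> \<longleftrightarrow> \<sigma> = BallotA \<or> \<sigma> = BallotAB"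
    and "PartyB \<in> approves \<sigma> \<longleftrightarrow> \<sigma> = BallotB \<or> \<sigma> = BallotAB" for \<sigma>
    by (cases \<sigma>; simp)+
  then show "{\<sigma>. PartyA \<in> approves \<sigma>} = {BallotA, BallotAB}"
    "{\<sigma>. PartyB \<in> approves \<sigma>} = {BallotB, BallotAB}" by auto
qed

lemma Delta_PartyA_iff:
  assumes "\<alpha> \<ge> 0" "\<zeta> \<ge> 0" "\<alpha> + \<zeta> > 0"
  shows "Delta (votes \<alpha> \<beta> \<zeta>) x PartyA = ereal d \<longleftrightarrow>
           \<alpha> * (x BallotA + d) + \<zeta> * (x BallotAB + d) = 1"
proof -
  define d0 where "d0 = (1 - \<alpha> * x BallotA - \<zeta> * x BallotAB) / (\<alpha> + \<zeta>)"
  have "\<alpha> * (x BallotA + e) + \<zeta> * (x BallotAB + e) = 1 \<longleftrightarrow> e = d0" for e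
    using assms(3) by (auto simp: d0_def field_simps)
  moreover have "on_some_ballot (votes \<alpha> \<beta> \<zeta>) PartyA"
    using assms unfolding on_some_ballot_def
    by (cases "\<alpha> > 0") (auto intro: exI[of _ BallotA] exI[of _ BallotAB])
  ultimately show ?thesis by (auto simp: Delta_def supporting_ballots)
qed

lemma Delta_PartyB_iff:
  assumes "\<beta> \<ge> 0" "\<zeta> \<ge> 0" "\<beta> + \<zeta> > 0"
  shows "Delta (votes \<alpha> \<beta> \<zeta>) x PartyB = ereal d \<longleftrightarrow>
           \<beta> * (x BallotB + d) + \<zeta> * (x BallotAB + d) = 1"
proof -
  define d0 where "d0 = (1 - \<beta> * x BallotB - \<zeta> * x BallotAB) / (\<beta> + \<zeta>)"
  have "\<beta> * (x BallotB + e) + \<zeta> * (x BallotAB + e) = 1 \<longleftrightarrow> e = d0" for e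
    using assms(3) by (auto simp: d0_def field_simps)
  moreover have "on_some_ballot (votes \<alpha> \<beta> \<zeta>) PartyB"
    using assms unfolding on_some_ballot_def
    by (cases "\<beta> > 0") (auto intro: exI[of _ BallotB] exI[of _ BallotAB])
  ultimately show ?thesis by (auto simp: Delta_def supporting_ballots)
qed

lemma phragmen_seats_exist: "\<exists>w. phragmen_seats v w"
proof -
  define g where "g x = (if Delta v x PartyA \<le> Delta v x PartyB then PartyA else PartyB)" for x
  define s where "s n = ((\<lambda>x. award v (g x) x) ^^ n) (\<lambda>_. 0)" for n
  define w where "w n = g (s n)" for n
  have "voting_power v w n = s n" for n
    by (induction n) (simp_all add: s_def w_def)
  moreover have "Delta v x (g x) \<le> Delta v x i" for x i
    by (cases i) (auto simp: g_def)
  ultimately show ?thesis unfolding phragmen_seats_def w_def by metis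
qed


section \<open>Rotation number\<close>

definition frac_plus :: "real \<Rightarrow> real" where
  "frac_plus x = 1 - frac (- x)"

definition f_pm :: "real \<Rightarrow> real \<Rightarrow> real \<Rightarrow> real set" where
  "f_pm a b x = {frac (a * x + b), frac_plus (a * x + b)}"

definition F_minus :: "real \<Rightarrow> real \<Rightarrow> real \<Rightarrow> real" where
  "F_minus a b x = a * x + b + (1 - a) * of_int \<lfloor>x\<rfloor>"

definition F_plus :: "real \<Rightarrow> real \<Rightarrow> real \<Rightarrow> real" where
  "F_plus a b x = a * x + b - (1 - a) * of_int \<lfloor>1 - x\<rfloor>"

text \<open>\<open>F_minus\<close> and \<open>F_plus\<close> are lifts of the two branches of the dynamical system \<open>f_pm\<close>.\<close>

lemma F_minus_lift: "frac (F_minus a b x) = frac (a * frac x + b)"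
proof -
  have "F_minus a b x = (a * frac x + b) + of_int \<lfloor>x\<rfloor>"
    by (simp add: F_minus_def frac_def algebra_simps)
  then show ?thesis by (simp add: frac_def)
qed

lemma F_plus_lift: "frac_plus (F_plus a b x) = frac_plus (a * frac_plus x + b)"
proof -
  have *: "1 - x = - x + of_int 1" by simp
  have fl: "\<lfloor>1 - x\<rfloor> = \<lfloor>- x\<rfloor> + 1" by (subst *) (simp only: floor_add_int [symmetric])
  have "- F_plus a b x = - (a * frac_plus x + b) + of_int \<lfloor>1 - x\<rfloor>"
    by (simp add: F_plus_def frac_plus_def frac_def fl algebra_simps)
  then show ?thesis unfolding frac_plus_def by (simp add: frac_def)
qed

definition is_rotation_number :: "real \<Rightarrow> real \<Rightarrow> real \<Rightarrow> bool" where
  "is_rotation_number a b \<rho> \<longleftrightarrow> 0 \<le> \<rho> \<and> \<rho> < 1 \<and>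
     (\<forall>x. (\<lambda>n. (F_minus a b ^^ n) x / real n) \<longlonglongrightarrow> \<rho> \<and>
          (\<lambda>n. (F_plus a b ^^ n) x / real n) \<longlonglongrightarrow> \<rho>)"

definition rotation_number :: "real \<Rightarrow> real \<Rightarrow> real" where
  "rotation_number a b = (THE \<rho>. is_rotation_number a b \<rho>)"

lemma rotation_number_eq: "is_rotation_number a b \<rho> \<Longrightarrow> rotation_number a b = \<rho>"
  unfolding rotation_number_def
  by (rule the_equality) (auto simp: is_rotation_number_def intro: LIMSEQ_unique)

end

theory Submission
  imports Defs
begin

text \<open>Suppose \<open>\<alpha> \<ge> \<beta> > 0\<close>. Ballots \<open>AB\<close> never keep any voting power, and a seat for \<open>B\<close> is followed
  by one for \<open>A\<close> (except in the degenerate case \<open>\<alpha> = \<beta> = 1/2\<close>, where the seats come in pairs).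
  So just after a seat for \<open>A\<close> the state is one number, which in a suitable affine coordinate \<open>z\<close>
  changes by \<open>z \<mapsto> z - 1\<close> for a seat for \<open>A\<close>, possible if \<open>z \<ge> 1\<close>, and by \<open>z \<mapsto> a z + b\<^sup>*\<close> for
  a seat for \<open>B\<close> followed by one for \<open>A\<close>, possible if \<open>z \<le> 1\<close>. Adding to \<open>z\<close> the excess of seats
  for \<open>A\<close> over seats for \<open>B\<close> gives an orbit of the lift of \<open>f_pm\<close>, with free choices at the integers.
  It lies between the orbits of \<open>F_plus\<close> and \<open>F_minus\<close>, which stay within bounded distance of a
  linear function.

  If \<open>a < 1\<close>, the two one-sided orbits of the discontinuity cannot both return to it, since
  they have the same rotation number but stay apart. Hence ties are eventually always broken the
  same way and the orbit follows a single monotone map of degree one. For rational \<open>\<rho> = p/q\<close> the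
  map \<open>F\<^sup>q - p\<close> moves every point of the orbit in the same direction and boundedly far, so the
  integer parts are eventually periodic modulo translation.\<close>

section \<open>Monotone maps of degree one\<close>

text \<open>Comparing \<open>s (m * n)\<close> with both \<open>m * s n\<close> and
  \<open>n * s m\<close> shows that the intervals from \<open>(s n - C) / n\<close> to
  \<open>(s n + C) / n\<close> pairwise intersect; the supremum of their left ends lies in all of
  them.\<close>

lemma almost_additive_linear:
  fixes s :: "nat \<Rightarrow> real"
  assumes s: "\<And>m n. \<bar>s (m + n) - s m - s n\<bar> \<le> C"
  obtains \<rho> where "\<And>n. \<bar>s n - real n * \<rho>\<bar> \<le> C"
proof -
  have mult: "\<bar>s (Suc m * n) - real (Suc m) * s n\<bar> \<le> real (Suc m) * C" for m n
  proof (induction m)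
    case 0
    show ?case using s[of 0 0] by simp
  next
    case (Suc m)
    have "s (Suc (Suc m) * n) = s (n + Suc m * n)" by simp
    then show ?case using s[of n "Suc m * n"] Suc by (simp add: algebra_simps abs_le_iff)
  qed
  have cross: "(s (Suc n) - C) / real (Suc n) \<le> (s (Suc m) + C) / real (Suc m)" for m n
  proof -
    have "real (Suc m) * s (Suc n) - real (Suc m) * C \<le> s (Suc m * Suc n)"
      using mult[of m "Suc n"] by linarith
    also have "\<dots> \<le> real (Suc n) * s (Suc m) + real (Suc n) * C"
      using mult[of n "Suc m"] by (simp only: mult.commute[of "Suc m" "Suc n"])
    finally show ?thesis by (simp add: divide_simps algebra_simps)
  qed
  define \<rho> where "\<rho> = (SUP n. (s (Suc n) - C) / real (Suc n))"
  have lower: "(s (Suc n) - C) / real (Suc n) \<le> \<rho>" for n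
    unfolding \<rho>_def by (rule cSUP_upper) (rule UNIV_I, rule bdd_aboveI2, rule cross[of _ 0])
  have upper: "\<rho> \<le> (s (Suc n) + C) / real (Suc n)" for n
    unfolding \<rho>_def by (rule cSUP_least) (use cross in auto)
  have "\<bar>s n - real n * \<rho>\<bar> \<le> C" for n
  proof (cases n)
    case 0
    then show ?thesis using s[of 0 0] by simp
  next
    case (Suc m)
    then show ?thesis using lower[of m] upper[of m]
      by (simp add: divide_simps algebra_simps abs_le_iff)
  qed
  then show thesis by (rule that)
qed

lemma bounded_deviation_tendsto:
  fixes y :: "nat \<Rightarrow> real"
  assumes "\<And>n. \<bar>y n - real n * p\<bar> \<le> C"
  shows "(\<lambda>n. y n / real n) \<longlonglongrightarrow> p"
proof -
  have "(\<lambda>n. y n / real n - p) \<longlonglongrightarrow> 0"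
  proof (rule tendsto_rabs_zero_cancel, rule tendsto_sandwich)
    show "\<forall>\<^sub>F n in sequentially. 0 \<le> \<bar>y n / real n - p\<bar>" by simp
    show "\<forall>\<^sub>F n in sequentially. \<bar>y n / real n - p\<bar> \<le> C / real n"
    proof (rule eventually_sequentiallyI[of 1])
      fix n :: nat assume "n \<ge> 1"
      then have "y n / real n - p = (y n - real n * p) / real n" by (simp add: field_simps)
      then show "\<bar>y n / real n - p\<bar> \<le> C / real n"
        using assms[of n] by (simp add: abs_divide divide_right_mono)
    qed
    show "(\<lambda>n. C / real n) \<longlonglongrightarrow> 0" by (rule lim_const_over_n)
  qed simp
  then show ?thesis by (rule LIM_zero_cancel)
qed

lemma incseq_bounded_int_eventually_const:
  fixes s :: "nat \<Rightarrow> int"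
  assumes "incseq s" and bnd: "\<And>n. s n \<le> B"
  obtains N where "\<And>n. n \<ge> N \<Longrightarrow> s n = s N"
proof -
  define d where "d = (LEAST d. \<exists>n. d = nat (B - s n))"
  have "\<exists>n. d = nat (B - s n)" unfolding d_def by (rule LeastI_ex) blast
  then obtain N where N: "d = nat (B - s N)" by blast
  have "s n = s N" if "n \<ge> N" for n
  proof -
    have "d \<le> nat (B - s n)" unfolding d_def by (rule Least_le) blast
    with N bnd[of n] have "s n \<le> s N" by linarith
    with incseqD[OF \<open>incseq s\<close> that] show ?thesis by simp
  qed
  then show thesis by (rule that)
qed

locale degree_one =
  fixes F :: "real \<Rightarrow> real"
  assumes mono: "mono F" and degree: "F (x + 1) = F x + 1"
begin

lemma shift: "F (x + of_int k) = F x + of_int k"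
proof (induction k arbitrary: x rule: int_induct[where k = 0])
  case base
  show ?case by simp
next
  case (step1 i)
  show ?case using degree[of "x + of_int i"] step1(2)[of x] by (simp add: algebra_simps)
next
  case (step2 i)
  show ?case using degree[of "x + of_int (i - 1)"] step2(2)[of x] by (simp add: algebra_simps)
qed

lemma iterate: "degree_one (F ^^ n)"
proof
  show "mono (F ^^ n)" by (induction n) (auto simp: mono_def intro: monoD[OF mono])
  show "(F ^^ n) (x + 1) = (F ^^ n) x + 1" for x by (induction n) (simp_all add: degree)
qed

text \<open>\<open>F x\<close> is squeezed between the images of the integers around
  \<open>x\<close>, which are translates of \<open>F 0\<close>.\<close>

lemma displacement: "\<bar>F x - x - F 0\<bar> \<le> 1"
proof -
  define k where "k = \<lfloor>x\<rfloor>"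
  have k: "of_int k \<le> x" "x \<le> of_int (k + 1)" unfolding k_def by linarith+
  have "F 0 + of_int k \<le> F x" "F x \<le> F 0 + of_int (k + 1)"
    using monoD[OF mono k(1)] monoD[OF mono k(2)] shift[of 0 k] shift[of 0 "k + 1"] by simp_all
  with k show ?thesis by simp
qed

lemma displacement_iterate: "\<bar>(F ^^ n) x - x - (F ^^ n) 0\<bar> \<le> 1"
  by (rule degree_one.displacement[OF iterate])

text \<open>By the displacement bound for \<open>F ^^ m\<close> at the point
  \<open>(F ^^ n) 0\<close>, the orbit of 0 is additive up to 1. Moving the starting point costs
  another 1.\<close>

lemma rotation_exists:
  obtains \<rho> where "\<And>n x. \<bar>(F ^^ n) x - x - real n * \<rho>\<bar> \<le> 2"
proof -
  have "\<bar>(F ^^ (m + n)) 0 - (F ^^ m) 0 - (F ^^ n) 0\<bar> \<le> 1" for m n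
    using displacement_iterate[of m "(F ^^ n) 0"] by (simp add: funpow_add)
  then obtain \<rho> where \<rho>: "\<And>n. \<bar>(F ^^ n) 0 - real n * \<rho>\<bar> \<le> 1"
    by (rule almost_additive_linear) blast
  have "\<bar>(F ^^ n) x - x - real n * \<rho>\<bar> \<le> 2" for n x
    using displacement_iterate[of n x] \<rho>[of n] by linarith
  then show thesis by (rule that)
qed

text \<open>With \<open>G = F\<^sup>q - p\<close> the orbit of \<open>x\<close> under \<open>G\<close> is monotone and bounded, so its image under
  an integer-valued monotone function stabilises. To treat all \<open>q\<close> residues of the time at
  once, one sums over a window of length \<open>q\<close>.\<close>

lemma eventually_periodic_increasing:
  fixes h :: "real \<Rightarrow> int"
  assumes rot: "\<And>n x. \<bar>(F ^^ n) x - x - real n * \<rho>\<bar> \<le> C"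
    and \<rho>: "real q * \<rho> = of_int p"
    and h: "mono h" "\<And>x k. h (x + of_int k) = h x + k"
    and up: "x + of_int p \<le> (F ^^ q) x"
  obtains N where "\<And>n. n \<ge> N \<Longrightarrow> h ((F ^^ (n + q)) x) = h ((F ^^ n) x) + p"
proof -
  have step: "h ((F ^^ n) x) + p \<le> h ((F ^^ (n + q)) x)" for n
  proof -
    have "(F ^^ n) x + of_int p = (F ^^ n) (x + of_int p)"
      by (rule degree_one.shift[OF iterate, symmetric])
    also have "\<dots> \<le> (F ^^ n) ((F ^^ q) x)"
      by (rule monoD[OF degree_one.mono[OF iterate] up])
    finally have "h ((F ^^ n) x + of_int p) \<le> h ((F ^^ (n + q)) x)"
      by (intro monoD[OF h(1)]) (simp add: funpow_add)
    then show ?thesis by (simp add: h(2))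
  qed
  define S where "S n = (\<Sum>i<q. h ((F ^^ (n + i)) x)) - int n * p" for n
  \<comment> \<open>Moving the window by one trades its first term for the one at time
    \<open>n + q\<close>, so the increment of \<open>S\<close> is exactly the nonnegative defect in
    \<open>step\<close>.\<close>
  have S_Suc: "S (Suc n) - S n = h ((F ^^ (n + q)) x) - h ((F ^^ n) x) - p" for n
  proof -
    have "(\<Sum>i<q. h ((F ^^ (n + Suc i)) x)) + h ((F ^^ n) x)
        = (\<Sum>i<q. h ((F ^^ (n + i)) x)) + h ((F ^^ (n + q)) x)"
      using sum.lessThan_Suc_shift[of "\<lambda>i. h ((F ^^ (n + i)) x)" q]
        sum.lessThan_Suc[of "\<lambda>i. h ((F ^^ (n + i)) x)" q] by simp
    then show ?thesis by (simp add: S_def algebra_simps)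
  qed
  have "incseq S"
    using S_Suc step by (intro incseq_SucI) (smt (verit))
  \<comment> \<open>Each of the \<open>q\<close> summands grows like \<open>n * \<rho>\<close>;
    their total \<open>n * (q * \<rho>)\<close> is cancelled by \<open>n * p\<close>. The term
    \<open>q * \<bar>\<rho>\<bar>\<close> covers the drift inside one window.\<close>
  moreover have "S n \<le> \<lceil>real q * (x + real q * \<bar>\<rho>\<bar> + C + of_int (h 1))\<rceil>" for n
  proof -
    have h_le: "of_int (h y) \<le> y + of_int (h 1)" for y
    proof -
      have "h y \<le> h (1 + of_int \<lfloor>y\<rfloor>)" by (rule monoD[OF h(1)]) linarith
      then show ?thesis unfolding h(2) by linarith
    qed
    have "of_int (h ((F ^^ (n + i)) x)) \<le> real n * \<rho> + (x + real q * \<bar>\<rho>\<bar> + C + of_int (h 1))"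
      if "i < q" for i
    proof -
      have "real i * \<rho> \<le> real i * \<bar>\<rho>\<bar>" by (intro mult_left_mono) auto
      also have "\<dots> \<le> real q * \<bar>\<rho>\<bar>" using that by (intro mult_right_mono) auto
      finally show ?thesis
        using rot[where n = "n + i" and x = x] h_le[of "(F ^^ (n + i)) x"]
        by (simp add: algebra_simps abs_le_iff)
    qed
    then have "(\<Sum>i<q. of_int (h ((F ^^ (n + i)) x)))
        \<le> (\<Sum>i<q. real n * \<rho> + (x + real q * \<bar>\<rho>\<bar> + C + of_int (h 1)))"
      by (intro sum_mono) auto
    also have "\<dots> = real n * (real q * \<rho>) + real q * (x + real q * \<bar>\<rho>\<bar> + C + of_int (h 1))"
      by (simp add: algebra_simps)
    finally have "of_int (S n) \<le> real q * (x + real q * \<bar>\<rho>\<bar> + C + of_int (h 1))"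
      unfolding \<rho> by (simp add: S_def)
    then show ?thesis by linarith
  qed
  ultimately obtain N where N: "\<And>n. n \<ge> N \<Longrightarrow> S n = S N"
    by (rule incseq_bounded_int_eventually_const) blast
  have "h ((F ^^ (n + q)) x) = h ((F ^^ n) x) + p" if "n \<ge> N" for n
    using S_Suc[of n] N[of n] N[of "Suc n"] that by simp
  then show thesis by (rule that)
qed

lemma reflect: "degree_one (\<lambda>x. - F (- x))"
proof
  show "mono (\<lambda>x. - F (- x))" by (auto simp: mono_def intro: monoD[OF mono])
  show "- F (- (x + 1)) = - F (- x) + 1" for x using degree[of "- x - 1"] by simp
qed

text \<open>If the orbit moves downwards, conjugation by the reflection of the line makes it move
  upwards, with \<rho>, \<open>p\<close> and \<open>h\<close> replaced by their reflections.\<close>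

lemma eventually_periodic:
  fixes h :: "real \<Rightarrow> int"
  assumes rot: "\<And>n x. \<bar>(F ^^ n) x - x - real n * \<rho>\<bar> \<le> C"
    and \<rho>: "real q * \<rho> = of_int p"
    and h: "mono h" "\<And>x k. h (x + of_int k) = h x + k"
  obtains N where "\<And>n. n \<ge> N \<Longrightarrow> h ((F ^^ (n + q)) x) = h ((F ^^ n) x) + p"
proof (cases "x + of_int p \<le> (F ^^ q) x")
  case True
  then show thesis
    using eventually_periodic_increasing[OF rot \<rho> h True] that by blast
next
  case False
  interpret r: degree_one "\<lambda>x. - F (- x)" by (rule reflect)
  have iter: "((\<lambda>x. - F (- x)) ^^ n) y = - (F ^^ n) (- y)" for n y
    by (induction n) simp_all
  have "\<bar>((\<lambda>x. - F (- x)) ^^ n) y - y - real n * (- \<rho>)\<bar> \<le> C" for n y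
    using rot[of n "- y"] unfolding iter by (simp add: abs_le_iff)
  moreover have "real q * (- \<rho>) = of_int (- p)" using \<rho> by simp
  moreover have "mono (\<lambda>x. - h (- x))" by (auto simp: mono_def intro: monoD[OF h(1)])
  moreover have "- h (- (y + of_int k)) = - h (- y) + k" for y k
    using h(2)[of "- y" "- k"] by simp
  moreover have "- x + of_int (- p) \<le> ((\<lambda>x. - F (- x)) ^^ q) (- x)"
    using False unfolding iter by simp
  ultimately obtain N where N: "\<And>n. n \<ge> N \<Longrightarrow>
      - h (- ((\<lambda>x. - F (- x)) ^^ (n + q)) (- x)) = - h (- ((\<lambda>x. - F (- x)) ^^ n) (- x)) + - p"
    by (rule r.eventually_periodic_increasing) blast
  show thesis
  proof (rule that)
    show "h ((F ^^ (n + q)) x) = h ((F ^^ n) x) + p" if "n \<ge> N" for n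
      using N[OF that] unfolding iter by simp
  qed
qed

end

section \<open>The rotation number\<close>

context
  fixes a b :: real
  assumes a: "0 < a" "a \<le> 1"
begin

lemma F_minus_strict_mono: "x < y \<Longrightarrow> F_minus a b x < F_minus a b y"
  unfolding F_minus_def using a
  by (smt (verit) floor_mono mult_left_mono mult_strict_left_mono of_int_le_iff)

lemma F_plus_strict_mono: "x < y \<Longrightarrow> F_plus a b x < F_plus a b y"
  unfolding F_plus_def using a
  by (smt (verit) floor_mono mult_left_mono mult_strict_left_mono of_int_le_iff)

lemma degree_one_F_minus: "degree_one (F_minus a b)"
proof
  show "mono (F_minus a b)"
    by (rule strict_mono_mono) (simp add: strict_mono_def F_minus_strict_mono)
  show "F_minus a b (x + 1) = F_minus a b x + 1" for x
    by (simp add: F_minus_def algebra_simps)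
qed

lemma degree_one_F_plus: "degree_one (F_plus a b)"
proof
  show "mono (F_plus a b)"
    by (rule strict_mono_mono) (simp add: strict_mono_def F_plus_strict_mono)
  show "F_plus a b (x + 1) = F_plus a b x + 1" for x
  proof -
    have "\<lfloor>1 - (x + 1)\<rfloor> = \<lfloor>1 - x\<rfloor> - 1" by linarith
    then show ?thesis unfolding F_plus_def by (simp only: of_int_diff) (simp add: algebra_simps)
  qed
qed

lemma F_plus_le_F_minus: "F_plus a b x \<le> F_minus a b x"
proof -
  have "- \<lfloor>1 - x\<rfloor> \<le> \<lfloor>x\<rfloor>" by linarith
  then have "of_int (- \<lfloor>1 - x\<rfloor>) \<le> (of_int \<lfloor>x\<rfloor> :: real)" by (simp only: of_int_le_iff)
  from mult_left_mono[OF this, of "1 - a"] a show ?thesis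
    by (simp add: F_plus_def F_minus_def)
qed

lemma F_minus_less_F_plus: "x < y \<Longrightarrow> F_minus a b x < F_plus a b y"
proof -
  assume "x < y"
  \<comment> \<open>\<open>- \<lfloor>1 - y\<rfloor>\<close> is the largest integer strictly below
    \<open>y\<close>.\<close>
  then have "\<lfloor>x\<rfloor> \<le> - \<lfloor>1 - y\<rfloor>" by linarith
  then have "of_int \<lfloor>x\<rfloor> \<le> (of_int (- \<lfloor>1 - y\<rfloor>) :: real)" by (simp only: of_int_le_iff)
  from mult_left_mono[OF this, of "1 - a"] a
  have "(1 - a) * of_int \<lfloor>x\<rfloor> \<le> - ((1 - a) * of_int \<lfloor>1 - y\<rfloor>)" by simp
  moreover have "a * x < a * y" by (rule mult_strict_left_mono[OF \<open>x < y\<close> a(1)])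
  ultimately show ?thesis unfolding F_plus_def F_minus_def by linarith
qed

lemma F_plus_iterate_le: "(F_plus a b ^^ n) x \<le> (F_minus a b ^^ n) x"
proof (induction n)
  case (Suc n)
  have "F_plus a b ((F_plus a b ^^ n) x) \<le> F_plus a b ((F_minus a b ^^ n) x)"
    by (rule monoD[OF degree_one.mono[OF degree_one_F_plus] Suc])
  also have "\<dots> \<le> F_minus a b ((F_minus a b ^^ n) x)" by (rule F_plus_le_F_minus)
  finally show ?case by simp
qed simp

lemma F_minus_iterate_less: "x < y \<Longrightarrow> (F_minus a b ^^ n) x < (F_plus a b ^^ n) y"
  by (induction n) (simp_all add: F_minus_less_F_plus)

text \<open>The orbit of \<open>x\<close> under \<open>F_plus\<close> stays between the orbits of
  \<open>x - 1\<close> and \<open>x\<close> under \<open>F_minus\<close>, so both maps share one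
  \<rho>, at the price of 1 in the bound.\<close>

lemma common_rotation_exists:
  obtains \<rho> where "\<And>n x. \<bar>(F_minus a b ^^ n) x - x - real n * \<rho>\<bar> \<le> 3"
    and "\<And>n x. \<bar>(F_plus a b ^^ n) x - x - real n * \<rho>\<bar> \<le> 3"
proof -
  obtain \<rho> where \<rho>: "\<And>n x. \<bar>(F_minus a b ^^ n) x - x - real n * \<rho>\<bar> \<le> 2"
    by (rule degree_one.rotation_exists[OF degree_one_F_minus]) blast
  have "\<bar>(F_minus a b ^^ n) x - x - real n * \<rho>\<bar> \<le> 3" for n x
    using \<rho>[of n x] by linarith
  moreover have "\<bar>(F_plus a b ^^ n) x - x - real n * \<rho>\<bar> \<le> 3" for n x
    using \<rho>[of n x] \<rho>[of n "x - 1"] F_plus_iterate_le[of n x] F_minus_iterate_less[of "x - 1" x n]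
    by (simp add: abs_le_iff)
  ultimately show thesis by (rule that)
qed

text \<open>The orbit of 0 under \<open>F_minus\<close> stays between 0 and \<open>n * b\<close>,
  which puts \<rho> between 0 and \<open>b\<close>, hence below 1 as the definite description
  demands.\<close>

lemma rotation_number_properties:
  assumes b: "0 \<le> b" "b < 1"
  shows "0 \<le> rotation_number a b" "rotation_number a b \<le> b"
    and "\<bar>(F_minus a b ^^ n) x - x - real n * rotation_number a b\<bar> \<le> 3"
    and "\<bar>(F_plus a b ^^ n) x - x - real n * rotation_number a b\<bar> \<le> 3"
proof -
  obtain \<rho> where minus: "\<And>n x. \<bar>(F_minus a b ^^ n) x - x - real n * \<rho>\<bar> \<le> 3"
    and plus: "\<And>n x. \<bar>(F_plus a b ^^ n) x - x - real n * \<rho>\<bar> \<le> 3"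
    using common_rotation_exists by blast
  have lim: "(\<lambda>n. y n / real n) \<longlonglongrightarrow> \<rho>"
    if y: "\<And>n. \<bar>y n - x - real n * \<rho>\<bar> \<le> 3" for x and y :: "nat \<Rightarrow> real"
  proof (rule bounded_deviation_tendsto)
    show "\<bar>y n - real n * \<rho>\<bar> \<le> 3 + \<bar>x\<bar>" for n using y[of n] by linarith
  qed
  have lower: "0 \<le> (F_minus a b ^^ n) 0" for n
  proof (induction n)
    case (Suc n)
    have "F_minus a b 0 \<le> F_minus a b ((F_minus a b ^^ n) 0)"
      by (rule monoD[OF degree_one.mono[OF degree_one_F_minus] Suc])
    moreover have "F_minus a b 0 = b" by (simp add: F_minus_def)
    ultimately show ?case using b by simp
  qed simp
  have upper: "(F_minus a b ^^ n) 0 \<le> real n * b" for n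
  proof (induction n)
    case (Suc n)
    have "F_minus a b y \<le> y + b" for y
    proof -
      have "(1 - a) * of_int \<lfloor>y\<rfloor> \<le> (1 - a) * y" using a by (intro mult_left_mono) auto
      then show ?thesis by (simp add: F_minus_def algebra_simps)
    qed
    from this[of "(F_minus a b ^^ n) 0"] Suc show ?case by (simp add: algebra_simps)
  qed simp
  have "0 \<le> \<rho>"
    by (rule LIMSEQ_le_const[OF lim[OF minus, of 0]]) (use lower in \<open>auto intro!: exI[of _ 1]\<close>)
  moreover have "\<rho> \<le> b"
    by (rule LIMSEQ_le_const2[OF lim[OF minus, of 0]])
      (use upper in \<open>auto intro!: exI[of _ 1] simp: divide_simps mult.commute\<close>)
  ultimately have "is_rotation_number a b \<rho>"
    using lim[OF minus] lim[OF plus] b unfolding is_rotation_number_def by simp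
  then have "rotation_number a b = \<rho>" by (rule rotation_number_eq)
  with \<open>0 \<le> \<rho>\<close> \<open>\<rho> \<le> b\<close> minus plus
  show "0 \<le> rotation_number a b" "rotation_number a b \<le> b"
    and "\<bar>(F_minus a b ^^ n) x - x - real n * rotation_number a b\<bar> \<le> 3"
    and "\<bar>(F_plus a b ^^ n) x - x - real n * rotation_number a b\<bar> \<le> 3" by simp_all
qed

end


section \<open>Orbits with arbitrary choices at the discontinuity\<close>

text \<open>A point of the circle is represented by \<open>W - M \<in> [0,1]\<close>, with both representatives of the
  discontinuity allowed; \<open>W\<close> follows \<open>F_minus\<close> or \<open>F_plus\<close>, the choice being free at integers.\<close>

locale mixed_orbit =
  fixes a b :: real and W :: "nat \<Rightarrow> real" and M :: "nat \<Rightarrow> int"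
  assumes a: "0 < a" "a \<le> 1"
    and W_Suc: "W (Suc j) = a * W j + b + (1 - a) * of_int (M j)"
    and M_le: "of_int (M j) \<le> W j" and M_ge: "W j \<le> of_int (M j) + 1"
begin

lemma M_cases: "M j = \<lfloor>W j\<rfloor> \<or> M j = - \<lfloor>1 - W j\<rfloor>"
  using M_le[of j] M_ge[of j] by linarith

lemma W_Suc_minus: "M j = \<lfloor>W j\<rfloor> \<Longrightarrow> W (Suc j) = F_minus a b (W j)"
  by (simp add: W_Suc F_minus_def)

lemma W_Suc_plus: "M j = - \<lfloor>1 - W j\<rfloor> \<Longrightarrow> W (Suc j) = F_plus a b (W j)"
  by (simp add: W_Suc F_plus_def)

lemma M_no_tie:
  assumes "W j \<notin> \<int>"
  shows "M j = \<lfloor>W j\<rfloor>" "M j = - \<lfloor>1 - W j\<rfloor>"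
proof -
  have "\<lfloor>W j\<rfloor> \<noteq> W j" using assms by (metis Ints_of_int)
  then have "\<lfloor>W j\<rfloor> = - \<lfloor>1 - W j\<rfloor>" by linarith
  then show "M j = \<lfloor>W j\<rfloor>" "M j = - \<lfloor>1 - W j\<rfloor>" using M_cases[of j] by auto
qed

text \<open>From the tie at \<open>i\<close> up to the next one no further choice arises, so
  \<open>W\<close> is an orbit segment of \<open>F\<close> between two integers; a translation makes
  it start at 0.\<close>

lemma return_to_tie:
  assumes follow: "\<And>j. j = i \<or> W j \<notin> \<int> \<Longrightarrow> W (Suc j) = F (W j)"
    and F: "degree_one F"
    and tie: "W i \<in> \<int>" and ties: "infinite {j. W j \<in> \<int>}"
  obtains r P where "r > 0" "(F ^^ r) 0 = of_int P"
proof -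
  obtain k where k: "k > i" "W k \<in> \<int>"
    using ties by (auto simp: infinite_nat_iff_unbounded)
  define d where "d = (LEAST d. d > 0 \<and> W (i + d) \<in> \<int>)"
  have d: "d > 0 \<and> W (i + d) \<in> \<int>" unfolding d_def
    by (rule LeastI[of _ "k - i"]) (use k in auto)
  have between: "W (i + e) \<notin> \<int>" if "0 < e" "e < d" for e
    using not_less_Least[of e "\<lambda>d. d > 0 \<and> W (i + d) \<in> \<int>"] that unfolding d_def by auto
  have "e \<le> d \<Longrightarrow> W (i + e) = (F ^^ e) (W i)" for e
  proof (induction e)
    case (Suc e)
    then have "e = 0 \<or> W (i + e) \<notin> \<int>" using between[of e] by auto
    then have "W (Suc (i + e)) = F (W (i + e))" by (intro follow) auto
    with Suc show ?case by simp
  qed simp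
  then have "W (i + d) = (F ^^ d) (W i)" by simp
  moreover obtain m n where "W i = of_int m" "W (i + d) = of_int n"
    using tie d by (auto elim!: Ints_cases)
  moreover have "(F ^^ d) (of_int m) = (F ^^ d) 0 + of_int m"
    using degree_one.shift[OF degree_one.iterate[OF F], of d 0 m] by simp
  ultimately have "(F ^^ d) 0 = of_int (n - m)" by simp
  with d that show thesis by blast
qed

lemma eventually_one_branch:
  assumes "a < 1"
  obtains N where "(\<forall>j\<ge>N. M j = \<lfloor>W j\<rfloor>) \<or> (\<forall>j\<ge>N. M j = - \<lfloor>1 - W j\<rfloor>)"
proof (cases "finite {j. W j \<in> \<int>}")
  case True
  then obtain N where "{j. W j \<in> \<int>} \<subseteq> {..<N}" unfolding finite_nat_iff_bounded by blast
  then have "\<forall>j\<ge>N. M j = \<lfloor>W j\<rfloor>" by (intro allI impI M_no_tie(1)) auto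
  then show thesis by (intro that disjI1)
next
  case ties: False
  text \<open>If both choices occurred at ties, then both iterates of the discontinuity would return to it.
    This is impossible, since the two orbits have the same rotation number but remain apart.\<close>
  have False if i: "M i \<noteq> - \<lfloor>1 - W i\<rfloor>" and k: "M k \<noteq> \<lfloor>W k\<rfloor>" for i k
  proof -
    note dm = degree_one_F_minus[OF a, of b] and dp = degree_one_F_plus[OF a, of b]
    have "W i \<in> \<int>" "W k \<in> \<int>" using i k M_no_tie by blast+
    have "W (Suc j) = F_minus a b (W j)" if "j = i \<or> W j \<notin> \<int>" for j
      using that i M_cases[of i] M_no_tie(1)[of j] by (intro W_Suc_minus) auto
    from return_to_tie[OF this dm \<open>W i \<in> \<int>\<close> ties]
    obtain r P where r: "r > 0" "(F_minus a b ^^ r) 0 = of_int P" by auto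
    have "W (Suc j) = F_plus a b (W j)" if "j = k \<or> W j \<notin> \<int>" for j
      using that k M_cases[of k] M_no_tie(2)[of j] by (intro W_Suc_plus) auto
    from return_to_tie[OF this dp \<open>W k \<in> \<int>\<close> ties]
    obtain s Q where s: "s > 0" "(F_plus a b ^^ s) 0 = of_int Q" by auto
    obtain \<rho> where minus: "\<And>n x. \<bar>(F_minus a b ^^ n) x - x - real n * \<rho>\<bar> \<le> 3"
      and plus: "\<And>n x. \<bar>(F_plus a b ^^ n) x - x - real n * \<rho>\<bar> \<le> 3"
      using common_rotation_exists[OF a, of b] by blast
    have iter: "(F ^^ (l * m)) 0 = of_int (int l * R)"
      if F: "degree_one F" and R: "(F ^^ m) 0 = of_int R" for F l m R
    proof (induction l)
      case (Suc l)
      have "(F ^^ (Suc l * m)) 0 = (F ^^ m) (0 + of_int (int l * R))"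
        using Suc by (simp add: funpow_add)
      also have "\<dots> = of_int (int (Suc l) * R)"
        unfolding degree_one.shift[OF degree_one.iterate[OF F]] R by (simp add: algebra_simps)
      finally show ?case .
    qed simp
    \<comment> \<open>Repeating the return \<open>l\<close> times multiplies the deviation
      \<open>R - m * \<rho>\<close> by \<open>l\<close>, while the bound stays 3.\<close>
    have rot: "of_int R = real m * \<rho>"
      if F: "degree_one F" and R: "(F ^^ m) 0 = of_int R"
        and bnd: "\<And>n x. \<bar>(F ^^ n) x - x - real n * \<rho>\<bar> \<le> 3" for F m R
    proof -
      have "real l * \<bar>of_int R - real m * \<rho>\<bar> \<le> 3" for l
        using bnd[of "l * m" 0] iter[OF F R, of l]
        by (simp add: abs_mult_pos' algebra_simps)
      then have "\<bar>of_int R - real m * \<rho>\<bar> = 0"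
        using real_archimedian_rdiv_eq_0[of "\<bar>of_int R - real m * \<rho>\<bar>" 3] by auto
      then show ?thesis by simp
    qed
    have "of_int P = real r * \<rho>" "of_int Q = real s * \<rho>"
      by (rule rot[OF dm r(2) minus], rule rot[OF dp s(2) plus])
    \<comment> \<open>At the common time \<open>s * r\<close> both orbits of 0 have returned, and
      the shared \<rho> puts them at the same integer.\<close>
    then have "(of_int (int s * P) :: real) = of_int (int r * Q)" by simp
    then have eq: "(F_minus a b ^^ (s * r)) 0 = (F_plus a b ^^ (s * r)) 0"
      using iter[OF dm r(2), of s] iter[OF dp s(2), of r] by (simp add: mult.commute)
    obtain l where l: "s * r = Suc l" using r s by (metis gr0_implies_Suc nat_0_less_mult_iff)
    \<comment> \<open>The first step separates the orbits: \<open>F_plus\<close> sends 0 to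
      \<open>b - (1 - a)\<close>, \<open>F_minus\<close> to \<open>b\<close>. Strict monotonicity
      keeps them apart.\<close>
    have "(F_plus a b ^^ Suc l) 0 \<le> (F_minus a b ^^ l) (F_plus a b 0)"
      by (simp add: funpow_Suc_right F_plus_iterate_le[OF a] del: funpow.simps)
    also have "\<dots> < (F_minus a b ^^ l) (F_minus a b 0)"
    proof -
      have "F_plus a b 0 < F_minus a b 0" using \<open>a < 1\<close> by (simp add: F_plus_def F_minus_def)
      moreover have "x < y \<Longrightarrow> (F_minus a b ^^ l) x < (F_minus a b ^^ l) y" for x y
        by (induction l) (simp_all add: F_minus_strict_mono[OF a])
      ultimately show ?thesis by blast
    qed
    finally show False using eq l by (simp add: funpow_Suc_right del: funpow.simps)
  qed
  then have "(\<forall>j\<ge>0. M j = \<lfloor>W j\<rfloor>) \<or> (\<forall>j\<ge>0. M j = - \<lfloor>1 - W j\<rfloor>)" by blast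
  then show thesis by (rule that)
qed

lemma rational_imp_eventually_periodic:
  assumes "a < 1" and b: "0 \<le> b" "b < 1" and "rotation_number a b \<in> \<rat>"
  obtains N q p where "q > 0" "\<And>j. j \<ge> N \<Longrightarrow> M (j + q) = M j + p"
proof -
  note outer = that
  obtain p q :: int where pq: "q > 0" "rotation_number a b = of_int p / of_int q"
    using Rats_cases'[OF assms(4)] by metis
  define q' where "q' = nat q"
  have q': "q' > 0" "real q' * rotation_number a b = of_int p" using pq by (simp_all add: q'_def)
  \<comment> \<open>Handles both branches at once: \<open>F\<close> and \<open>h\<close> will be
    \<open>F_minus\<close> with the floor, or \<open>F_plus\<close> with the largest integer
    strictly below.\<close>
  have *: thesis
    if F: "degree_one F" and bnd: "\<And>n x. \<bar>(F ^^ n) x - x - real n * rotation_number a b\<bar> \<le> 3"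
      and h: "mono h" "\<And>x k. h (x + of_int k) = h x + k"
      and W: "\<And>j. j \<ge> N \<Longrightarrow> W (Suc j) = F (W j)" and M: "\<And>j. j \<ge> N \<Longrightarrow> M j = h (W j)"
    for F h N
  proof -
    have iter: "W (N + n) = (F ^^ n) (W N)" for n
      by (induction n) (simp_all add: W)
    obtain L where L: "\<And>n. n \<ge> L \<Longrightarrow> h ((F ^^ (n + q')) (W N)) = h ((F ^^ n) (W N)) + p"
      using degree_one.eventually_periodic[OF F bnd q'(2) h] by blast
    have "M (j + q') = M j + p" if "j \<ge> N + L" for j
    proof -
      define n where "n = j - N"
      have "j = N + n" "n \<ge> L" using that by (simp_all add: n_def)
      then show ?thesis using L[of n] M[of j] M[of "j + q'"] iter[of n] iter[of "n + q'"]
        by (simp add: add.assoc)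
    qed
    with q'(1) show thesis by (rule outer)
  qed
  obtain N where "(\<forall>j\<ge>N. M j = \<lfloor>W j\<rfloor>) \<or> (\<forall>j\<ge>N. M j = - \<lfloor>1 - W j\<rfloor>)"
    by (rule eventually_one_branch[OF \<open>a < 1\<close>])
  then show thesis
  proof
    assume "\<forall>j\<ge>N. M j = \<lfloor>W j\<rfloor>"
    then show thesis
      by (intro *[OF degree_one_F_minus[OF a] rotation_number_properties(3)[OF a b], of floor N])
        (auto simp: mono_def floor_mono W_Suc_minus)
  next
    assume "\<forall>j\<ge>N. M j = - \<lfloor>1 - W j\<rfloor>"
    moreover have "- \<lfloor>1 - (x + of_int k)\<rfloor> = - \<lfloor>1 - x\<rfloor> + k" for x :: real and k by linarith
    ultimately show thesis
      by (intro *[OF degree_one_F_plus[OF a] rotation_number_properties(4)[OF a b],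
            of "\<lambda>x. - \<lfloor>1 - x\<rfloor>" N])
        (auto simp: mono_def floor_mono W_Suc_plus)
  qed
qed

lemma deviation_bounded:
  assumes b: "0 \<le> b" "b < 1"
  shows "\<bar>W j - W 0 - real j * rotation_number a b\<bar> \<le> 3"
proof -
  have "F_plus a b (W j) \<le> W (Suc j)" "W (Suc j) \<le> F_minus a b (W j)" for j
    using M_cases[of j] W_Suc_minus[of j] W_Suc_plus[of j] F_plus_le_F_minus[OF a, of b "W j"]
    by auto
  note step = this
  have "(F_plus a b ^^ j) (W 0) \<le> W j"
  proof (induction j)
    case (Suc j)
    then show ?case
      using monoD[OF degree_one.mono[OF degree_one_F_plus[OF a]] Suc, of b] step(1)[of j] by simp
  qed simp
  moreover have "W j \<le> (F_minus a b ^^ j) (W 0)"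
  proof (induction j)
    case (Suc j)
    then show ?case
      using monoD[OF degree_one.mono[OF degree_one_F_minus[OF a]] Suc, of b] step(2)[of j] by simp
  qed simp
  ultimately show ?thesis
    using rotation_number_properties(3)[OF a b, of j "W 0"]
      rotation_number_properties(4)[OF a b, of j "W 0"] by linarith
qed

end

section \<open>Counting seats\<close>

lemma seats_0 [simp]: "seats w i 0 = 0"
  by (simp add: seats_def)

lemma seats_Suc: "seats w i (Suc n) = seats w i n + (if w n = i then 1 else 0)"
proof -
  have "{k. k < Suc n \<and> w k = i} = {k. k < n \<and> w k = i} \<union> (if w n = i then {n} else {})"
    by (auto simp: less_Suc_eq)
  then show ?thesis by (simp add: seats_def)
qed

lemma seats_add: "seats w PartyA n + seats w PartyB n = n"
proof (induction n)
  case (Suc n)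
  then show ?case by (cases "w n") (simp_all add: seats_Suc)
qed simp

lemma seats_mono: "m \<le> n \<Longrightarrow> seats w i m \<le> seats w i n"
  unfolding seats_def by (rule card_mono) auto

lemma seats_less: "w m = i \<Longrightarrow> m < n \<Longrightarrow> seats w i m < seats w i n"
  using seats_mono[of "Suc m" n w i] by (simp add: seats_Suc)

lemma seats_inj: "w m = i \<Longrightarrow> w n = i \<Longrightarrow> seats w i m = seats w i n \<Longrightarrow> m = n"
  using seats_less[of w m i n] seats_less[of w n i m] by (metis nat_neq_iff)

definition seat_time :: "(nat \<Rightarrow> 'a) \<Rightarrow> 'a \<Rightarrow> nat \<Rightarrow> nat" where
  "seat_time w i j = (THE n. w n = i \<and> card {k. k < n \<and> w k = i} = j)"

lemma seat_time_seats: "w n = i \<Longrightarrow> seat_time w i (seats w i n) = n"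
  unfolding seat_time_def seats_def[symmetric]
  by (rule the_equality) (auto intro: seats_inj)

lemma seats_unbounded_nth:
  assumes "seats w i n > j"
  obtains m where "w m = i" "seats w i m = j"
proof -
  define l where "l = (LEAST n. seats w i n > j)"
  have l: "seats w i l > j" unfolding l_def using assms by (rule LeastI)
  then obtain m where m: "l = Suc m" by (cases l) auto
  then have "seats w i m \<le> j" using not_less_Least[of m "\<lambda>n. seats w i n > j"] by (simp add: l_def)
  with l m have "w m = i" "seats w i m = j" by (auto simp: seats_Suc split: if_splits)
  then show thesis by (rule that)
qed

lemma seats_asymptotics:
  assumes "\<And>n. \<bar>real (seats w PartyB n) - real n * p\<bar> \<le> C"
  shows "(\<lambda>n. real (seats w PartyA n) / real n) \<longlonglongrightarrow> 1 - p \<and>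
      (\<lambda>n. real (seats w PartyB n) / real n) \<longlonglongrightarrow> p \<and>
      (\<lambda>n. real (seats w PartyA n) - (1 - p) * real n) \<in> O(\<lambda>_. 1) \<and>
      (\<lambda>n. real (seats w PartyB n) - p * real n) \<in> O(\<lambda>_. 1)"
proof -
  have A: "\<bar>real (seats w PartyA n) - real n * (1 - p)\<bar> \<le> C" for n
  proof -
    have "real (seats w PartyA n) - real n * (1 - p) = - (real (seats w PartyB n) - real n * p)"
      using seats_add[of w n] by (simp add: algebra_simps flip: of_nat_add)
    then show ?thesis using assms[of n] by simp
  qed
  have "(\<lambda>n. real (seats w i n) - q * real n) \<in> O(\<lambda>_. 1)"
    if "\<And>n. \<bar>real (seats w i n) - real n * q\<bar> \<le> C" for i q
    by (rule bigoI[of _ C]) (use that in \<open>simp add: mult.commute\<close>)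
  with A assms bounded_deviation_tendsto[OF A] bounded_deviation_tendsto[OF assms]
  show ?thesis by blast
qed

section \<open>Exchanging the parties\<close>

fun swap_party :: "party \<Rightarrow> party" where
  "swap_party PartyA = PartyB"
| "swap_party PartyB = PartyA"

fun swap_ballot :: "ballot \<Rightarrow> ballot" where
  "swap_ballot BallotA = BallotB"
| "swap_ballot BallotB = BallotA"
| "swap_ballot BallotAB = BallotAB"

lemma on_some_ballot_votes:
  "on_some_ballot (votes \<alpha> \<beta> \<zeta>) PartyA \<longleftrightarrow> \<alpha> > 0 \<or> \<zeta> > 0"
  "on_some_ballot (votes \<alpha> \<beta> \<zeta>) PartyB \<longleftrightarrow> \<beta> > 0 \<or> \<zeta> > 0"
proof -
  have ex: "(\<exists>\<sigma>. P \<sigma>) \<longleftrightarrow> P BallotA \<or> P BallotB \<or> P BallotAB" for P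
    by (metis ballot.exhaust)
  show "on_some_ballot (votes \<alpha> \<beta> \<zeta>) PartyA \<longleftrightarrow> \<alpha> > 0 \<or> \<zeta> > 0"
    "on_some_ballot (votes \<alpha> \<beta> \<zeta>) PartyB \<longleftrightarrow> \<beta> > 0 \<or> \<zeta> > 0"
    by (auto simp: on_some_ballot_def ex)
qed

lemma Delta_swap:
  "Delta (votes \<beta> \<alpha> \<zeta>) (x \<circ> swap_ballot) (swap_party i) = Delta (votes \<alpha> \<beta> \<zeta>) x i"
  by (cases i) (simp_all add: Delta_def on_some_ballot_votes supporting_ballots)

lemma voting_power_swap:
  "voting_power (votes \<beta> \<alpha> \<zeta>) (swap_party \<circ> w) n = voting_power (votes \<alpha> \<beta> \<zeta>) w n \<circ> swap_ballot"
proof (induction n)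
  case (Suc n)
  have "swap_party i \<in> approves \<sigma> \<longleftrightarrow> i \<in> approves (swap_ballot \<sigma>)" for i \<sigma>
    by (cases i; cases \<sigma>) simp_all
  moreover have "Delta (votes \<beta> \<alpha> \<zeta>) (voting_power (votes \<beta> \<alpha> \<zeta>) (swap_party \<circ> w) n) (swap_party (w n))
      = Delta (votes \<alpha> \<beta> \<zeta>) (voting_power (votes \<alpha> \<beta> \<zeta>) w n) (w n)"
    unfolding Suc by (rule Delta_swap)
  moreover have "voting_power (votes \<beta> \<alpha> \<zeta>) (swap_party \<circ> w) n \<sigma>
      = voting_power (votes \<alpha> \<beta> \<zeta>) w n (swap_ballot \<sigma>)" for \<sigma>
    by (simp add: Suc)
  ultimately show ?case by (simp add: award_def fun_eq_iff del: comp_apply) auto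
qed (simp add: fun_eq_iff)

lemma phragmen_seats_swap:
  assumes "phragmen_seats (votes \<alpha> \<beta> \<zeta>) w"
  shows "phragmen_seats (votes \<beta> \<alpha> \<zeta>) (swap_party \<circ> w)"
proof -
  have "Delta (votes \<beta> \<alpha> \<zeta>) (voting_power (votes \<beta> \<alpha> \<zeta>) (swap_party \<circ> w) n) (swap_party i)
      = Delta (votes \<alpha> \<beta> \<zeta>) (voting_power (votes \<alpha> \<beta> \<zeta>) w n) i" for n i
    by (simp add: voting_power_swap Delta_swap)
  moreover have "\<exists>i. j = swap_party i" for j by (cases j) (metis swap_party.simps)+
  ultimately show ?thesis
    using assms unfolding phragmen_seats_def comp_apply by metis
qed

lemma seats_swap:
  "seats (swap_party \<circ> w) PartyA n = seats w PartyB n"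
  "seats (swap_party \<circ> w) PartyB n = seats w PartyA n"
proof -
  have "swap_party i = PartyA \<longleftrightarrow> i = PartyB" "swap_party i = PartyB \<longleftrightarrow> i = PartyA" for i
    by (cases i; simp)+
  then show "seats (swap_party \<circ> w) PartyA n = seats w PartyB n"
    "seats (swap_party \<circ> w) PartyB n = seats w PartyA n" by (simp_all add: seats_def)
qed

section \<open>The dynamics of the free voting powers\<close>

lemma voting_power_BallotAB: "voting_power v w n BallotAB = 0"
proof (cases n)
  case (Suc m)
  then show ?thesis by (cases "w m") (simp_all add: award_def)
qed simp

text \<open>As \<open>\<alpha> + \<zeta> = 1\<close>, party A always needs 1, its ballots being
  reset at each of its seats, while B needs \<open>1 / \<zeta> > 1\<close>, or infinity if
  \<open>\<zeta> = 0\<close>.\<close>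

lemma no_B_ballots_imp_all_A:
  assumes "\<alpha> > 0" "\<zeta> = 1 - \<alpha>" "\<zeta> \<ge> 0" and w: "phragmen_seats (votes \<alpha> 0 \<zeta>) w"
  shows "w n = PartyA"
proof -
  define x where "x = voting_power (votes \<alpha> 0 \<zeta>) w"
  have DA: "Delta (votes \<alpha> 0 \<zeta>) y PartyA = ereal 1" if "y BallotA = 0" "y BallotAB = 0" for y
    using Delta_PartyA_iff[of \<alpha> \<zeta> 0 y 1] assms that by simp
  have DB: "Delta (votes \<alpha> 0 \<zeta>) y PartyB > ereal 1" if "y BallotAB = 0" for y
  proof (cases "\<zeta> = 0")
    case True
    then show ?thesis by (simp add: Delta_def on_some_ballot_votes)
  next
    case False
    then have "Delta (votes \<alpha> 0 \<zeta>) y PartyB = ereal (1 / \<zeta>)"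
      using Delta_PartyB_iff[of 0 \<zeta> \<alpha> y "1 / \<zeta>"] assms that by simp
    then show ?thesis using assms False by (simp add: divide_simps)
  qed
  have "w n = PartyA" if "x n BallotA = 0" for n
  proof (rule ccontr)
    assume "w n \<noteq> PartyA"
    then have "w n = PartyB" by (cases "w n") auto
    then have "Delta (votes \<alpha> 0 \<zeta>) (x n) PartyB \<le> Delta (votes \<alpha> 0 \<zeta>) (x n) PartyA"
      using w unfolding phragmen_seats_def x_def by metis
    then show False
      using DA[of "x n"] DB[of "x n"] that by (simp add: x_def voting_power_BallotAB)
  qed
  moreover have "x n BallotA = 0" for n
  proof (induction n)
    case (Suc n)
    from \<open>x n BallotA = 0 \<Longrightarrow> w n = PartyA\<close>[OF Suc] show ?case by (simp add: x_def award_def)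
  qed (simp add: x_def)
  ultimately show ?thesis by blast
qed

lemma contraction_ratio_bounds:
  fixes \<alpha> \<beta> \<zeta> :: real
  assumes "0 < \<beta>" "\<beta> \<le> \<alpha>" and \<zeta>: "\<zeta> = 1 - \<alpha> - \<beta>" "0 \<le> \<zeta>"
  defines "a \<equiv> \<alpha> * \<beta> / ((1 - \<alpha>) * (1 - \<beta>))"
  shows "0 < a" "a \<le> 1" "a < 1 \<longleftrightarrow> \<zeta> > 0"
proof -
  have "(1 - \<alpha>) * (1 - \<beta>) = \<zeta> + \<alpha> * \<beta>" using \<zeta> by (simp add: algebra_simps)
  then have "a = \<alpha> * \<beta> / (\<zeta> + \<alpha> * \<beta>)" by (simp add: a_def)
  moreover have "\<alpha> * \<beta> > 0" using assms by simp
  ultimately show "0 < a" "a \<le> 1" "a < 1 \<longleftrightarrow> \<zeta> > 0"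
    using \<zeta>(2) by (simp_all add: zero_less_divide_iff divide_le_eq divide_less_eq add_nonneg_pos)
qed

locale phragmen_run =
  fixes \<alpha> \<beta> \<zeta> :: real and w :: "nat \<Rightarrow> party"
  assumes \<beta>: "0 < \<beta>" "\<beta> \<le> \<alpha>" and \<zeta>: "\<zeta> = 1 - \<alpha> - \<beta>" "0 \<le> \<zeta>"
    and run: "phragmen_seats (votes \<alpha> \<beta> \<zeta>) w"
begin

definition x :: "nat \<Rightarrow> ballot \<Rightarrow> real" where
  "x = voting_power (votes \<alpha> \<beta> \<zeta>) w"

abbreviation nB :: "nat \<Rightarrow> nat" where
  "nB \<equiv> seats w PartyB"

lemma proportions_less_1: "\<alpha> < 1" "\<beta> < 1"
  using \<beta> \<zeta> by auto

lemma x_0 [simp]: "x 0 \<sigma> = 0"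
  by (simp add: x_def)

lemma Delta_A: "Delta (votes \<alpha> \<beta> \<zeta>) (x n) PartyA = ereal ((1 - \<alpha> * x n BallotA) / (1 - \<beta>))"
proof -
  define d where "d = (1 - \<alpha> * x n BallotA) / (1 - \<beta>)"
  have "\<alpha> * (x n BallotA + d) + \<zeta> * (0 + d) = \<alpha> * x n BallotA + (1 - \<beta>) * d"
    unfolding \<zeta>(1) by (simp add: algebra_simps)
  also have "\<dots> = 1" using proportions_less_1 by (simp add: d_def)
  finally show ?thesis
    using \<beta> \<zeta>(2) unfolding d_def[symmetric]
    by (subst Delta_PartyA_iff) (simp_all add: x_def voting_power_BallotAB)
qed

lemma Delta_B: "Delta (votes \<alpha> \<beta> \<zeta>) (x n) PartyB = ereal ((1 - \<beta> * x n BallotB) / (1 - \<alpha>))"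
proof -
  define d where "d = (1 - \<beta> * x n BallotB) / (1 - \<alpha>)"
  have "\<beta> * (x n BallotB + d) + \<zeta> * (0 + d) = \<beta> * x n BallotB + (1 - \<alpha>) * d"
    unfolding \<zeta>(1) by (simp add: algebra_simps)
  also have "\<dots> = 1" using proportions_less_1 by (simp add: d_def)
  finally show ?thesis
    using \<beta> \<zeta>(2) unfolding d_def[symmetric]
    by (subst Delta_PartyB_iff) (simp_all add: x_def voting_power_BallotAB)
qed

lemma award_A:
  assumes "w n = PartyA"
  shows "x (Suc n) BallotA = 0"
    "x (Suc n) BallotB = x n BallotB + (1 - \<alpha> * x n BallotA) / (1 - \<beta>)"
    "(1 - \<alpha> * x n BallotA) / (1 - \<beta>) \<le> (1 - \<beta> * x n BallotB) / (1 - \<alpha>)"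
proof -
  show "x (Suc n) BallotA = 0"
    "x (Suc n) BallotB = x n BallotB + (1 - \<alpha> * x n BallotA) / (1 - \<beta>)"
    using assms by (simp_all add: x_def award_def Delta_A[unfolded x_def])
  have "Delta (votes \<alpha> \<beta> \<zeta>) (x n) PartyA \<le> Delta (votes \<alpha> \<beta> \<zeta>) (x n) PartyB"
    using run assms unfolding phragmen_seats_def x_def by metis
  then show "(1 - \<alpha> * x n BallotA) / (1 - \<beta>) \<le> (1 - \<beta> * x n BallotB) / (1 - \<alpha>)"
    by (simp add: Delta_A Delta_B)
qed

lemma award_B:
  assumes "w n = PartyB"
  shows "x (Suc n) BallotB = 0"
    "x (Suc n) BallotA = x n BallotA + (1 - \<beta> * x n BallotB) / (1 - \<alpha>)"
    "(1 - \<beta> * x n BallotB) / (1 - \<alpha>) \<le> (1 - \<alpha> * x n BallotA) / (1 - \<beta>)"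
proof -
  show "x (Suc n) BallotB = 0"
    "x (Suc n) BallotA = x n BallotA + (1 - \<beta> * x n BallotB) / (1 - \<alpha>)"
    using assms by (simp_all add: x_def award_def Delta_B[unfolded x_def])
  have "Delta (votes \<alpha> \<beta> \<zeta>) (x n) PartyB \<le> Delta (votes \<alpha> \<beta> \<zeta>) (x n) PartyA"
    using run assms unfolding phragmen_seats_def x_def by metis
  then show "(1 - \<beta> * x n BallotB) / (1 - \<alpha>) \<le> (1 - \<alpha> * x n BallotA) / (1 - \<beta>)"
    by (simp add: Delta_A Delta_B)
qed

text \<open>Here a seat for B may be followed by another one, as in A B B A, so this case stands
  apart. From the zero state either party may win; then the other one is forced and the state
  returns to zero.\<close>

lemma balanced_deviation:
  assumes "\<alpha> = 1 / 2" "\<beta> = 1 / 2"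
  shows "\<bar>real (nB n) - real n * (1 / 2)\<bar> \<le> 1 / 2"
proof -
  have A: "x (Suc n) BallotA = 0" "x (Suc n) BallotB = x n BallotB + 2 - x n BallotA"
    "x n BallotB \<le> x n BallotA" if "w n = PartyA" for n
    using award_A[OF that] by (simp_all add: assms)
  have B: "x (Suc n) BallotB = 0" "x (Suc n) BallotA = x n BallotA + 2 - x n BallotB"
    "x n BallotA \<le> x n BallotB" if "w n = PartyB" for n
    using award_B[OF that] by (simp_all add: assms)
  have "(x n BallotA = 0 \<and> x n BallotB = 0 \<and> n = 2 * nB n) \<or>
        (x n BallotA = 0 \<and> x n BallotB = 2 \<and> n = 2 * nB n + 1) \<or>
        (x n BallotA = 2 \<and> x n BallotB = 0 \<and> n + 1 = 2 * nB n)"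
  proof (induction n)
    case (Suc n)
    show ?case
    proof (cases "w n")
      case PartyA
      then show ?thesis using Suc A[OF PartyA] by (auto simp: seats_Suc)
    next
      case PartyB
      then show ?thesis using Suc B[OF PartyB] by (auto simp: seats_Suc)
    qed
  qed simp
  then have "n = 2 * nB n \<or> n = 2 * nB n + 1 \<or> n + 1 = 2 * nB n" by blast
  then have "real n = 2 * real (nB n) \<or> real n = 2 * real (nB n) + 1 \<or> real n + 1 = 2 * real (nB n)"
    by linarith
  then show ?thesis by (auto simp: field_simps)
qed

end

section \<open>All runs but the case \<alpha> = \<beta> = 1/2, read as orbits of the circle
  map\<close>

locale unbalanced_run = phragmen_run +
  assumes unbalanced: "\<beta> < \<alpha> \<or> 0 < \<zeta>"
begin

definition "a = \<alpha> * \<beta> / ((1 - \<alpha>) * (1 - \<beta>))"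
definition "bstar = (\<alpha> - \<beta>) / \<beta> + \<alpha> * (1 - \<alpha> - \<beta>) / ((1 - \<alpha>) * (1 - \<beta>))"
definition "b = bstar - of_int \<lfloor>bstar\<rfloor>"
definition "b0 = \<lfloor>bstar\<rfloor>"
text \<open>When seat number \<open>j\<close> (from 0) for B is awarded,
  \<open>seat_time w PartyB j - 2 * j\<close> is the excess of A seats over B seats. Subtracting
  \<open>b0\<close> per B seat reduces the translation \<open>bstar\<close> to
  \<open>b\<close>.\<close>

definition "M j = int (seat_time w PartyB j) - (b0 + 2) * int j"

primrec W :: "nat \<Rightarrow> real" where
  "W 0 = 1 + (\<alpha> - \<beta>) / \<beta>"
| "W (Suc j) = a * W j + b + (1 - a) * of_int (M j)"

text \<open>The circle coordinate as a function of the free voting power \<open>y\<close> of ballots \<open>B\<close> at a time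
  when those of \<open>A\<close> and \<open>AB\<close> are zero: each seat for \<open>A\<close> lowers it by 1, and a seat for \<open>B\<close> becomes
  possible once it is at most 1.\<close>

definition "coord y = 1 + (\<alpha> - \<beta>) / \<beta> - (1 - \<beta>) * y"

lemmas a_bounds = contraction_ratio_bounds[OF \<beta> \<zeta>, folded a_def]

lemma b_bounds: "0 \<le> b" "b < 1"
  unfolding b_def by linarith+

lemma bstar_nonneg: "0 \<le> bstar"
  unfolding bstar_def using \<beta> \<zeta> proportions_less_1
  by (intro add_nonneg_nonneg divide_nonneg_nonneg mult_nonneg_nonneg) auto

lemma b0_nonneg: "0 \<le> b0"
  using bstar_nonneg by (simp add: b0_def)

lemma bstar_eq: "bstar = b + of_int b0"
  by (simp add: b_def b0_def)

lemma coord_0: "coord 0 = W 0"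
  by (simp add: coord_def)

lemma coord_award_A: "coord (y + 1 / (1 - \<beta>)) = coord y - 1"
  using proportions_less_1 by (simp add: coord_def field_simps)

text \<open>The argument of \<open>coord\<close> on the left is the power of B ballots after a seat
  for B and then one for A, starting from \<open>y\<close> with A ballots at 0.\<close>

lemma coord_award_B_A:
  "coord ((1 - \<alpha> * ((1 - \<beta> * y) / (1 - \<alpha>))) / (1 - \<beta>)) = a * coord y + bstar"
  using proportions_less_1 \<beta>(1)
  by (simp add: coord_def a_def bstar_def divide_simps) (simp add: algebra_simps)

text \<open>With A ballots at power 0, the left side says that A may take the seat.
  \<open>coord_le_1_iff\<close> is the analogue for B, so ties are the states of coordinate
  1.\<close>

lemma coord_ge_1_iff: "1 / (1 - \<beta>) \<le> (1 - \<beta> * y) / (1 - \<alpha>) \<longleftrightarrow> 1 \<le> coord y"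
proof -
  have "1 / (1 - \<beta>) \<le> (1 - \<beta> * y) / (1 - \<alpha>) \<longleftrightarrow> \<beta> * ((1 - \<beta>) * y) \<le> \<alpha> - \<beta>"
    using proportions_less_1 by (simp add: divide_simps algebra_simps)
  also have "\<dots> \<longleftrightarrow> 1 \<le> coord y"
    using \<beta>(1) by (simp add: coord_def pos_le_divide_eq mult.commute)
  finally show ?thesis .
qed

lemma coord_le_1_iff: "(1 - \<beta> * y) / (1 - \<alpha>) \<le> 1 / (1 - \<beta>) \<longleftrightarrow> coord y \<le> 1"
proof -
  have "(1 - \<beta> * y) / (1 - \<alpha>) \<le> 1 / (1 - \<beta>) \<longleftrightarrow> \<alpha> - \<beta> \<le> \<beta> * ((1 - \<beta>) * y)"
    using proportions_less_1 by (simp add: divide_simps algebra_simps)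
  also have "\<dots> \<longleftrightarrow> coord y \<le> 1"
    using \<beta>(1) by (simp add: coord_def pos_divide_le_eq mult.commute)
  finally show ?thesis .
qed

text \<open>Seats for A lower the coordinate, and a return through a seat for B starts from at most
  1, so it ends at most at \<open>a + bstar\<close>; \<open>W 0\<close> covers the initial
  state.\<close>

definition "bound = W 0 + a + bstar"

text \<open>\<open>n - 2 * nB n\<close> is the excess of A seats over B seats;
  \<open>b0 * nB n\<close> restores the integer parts dropped by using \<open>b\<close> for
  \<open>bstar\<close> in \<open>W\<close>.\<close>

definition in_phase_A :: "nat \<Rightarrow> bool" where
  "in_phase_A n \<longleftrightarrow> x n BallotA = 0 \<and>
     coord (x n BallotB) = W (nB n) + of_int b0 * real (nB n) - (real n - 2 * real (nB n)) \<and>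
     0 \<le> coord (x n BallotB) \<and> coord (x n BallotB) \<le> bound"

text \<open>After a seat for \<open>B\<close> the next seat goes to \<open>A\<close>; the coordinate is the one reached after it.\<close>

definition in_phase_B :: "nat \<Rightarrow> bool" where
  "in_phase_B n \<longleftrightarrow> x n BallotB = 0 \<and> 0 \<le> x n BallotA \<and> (\<beta> < \<alpha> \<or> 0 < x n BallotA) \<and>
     (let z = coord ((1 - \<alpha> * x n BallotA) / (1 - \<beta>))
      in z = W (nB n) + of_int b0 * real (nB n) - (real n + 1 - 2 * real (nB n)) \<and>
         0 \<le> z \<and> z \<le> bound)"

lemma phase_A_award_A:
  assumes "in_phase_A n" "w n = PartyA"
  shows "in_phase_A (Suc n)"
  using assms award_A[OF assms(2)] coord_ge_1_iff[of "x n BallotB"]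
    coord_award_A[of "x n BallotB"]
  by (simp add: in_phase_A_def seats_Suc del: W.simps)

lemma phase_A_award_B:
  assumes "in_phase_A n" "w n = PartyB"
  shows "in_phase_B (Suc n)" "coord (x n BallotB) \<le> 1"
proof -
  define y where "y = x n BallotB"
  have y: "x n BallotA = 0" "0 \<le> coord y"
    "coord y = W (nB n) + of_int b0 * real (nB n) - (real n - 2 * real (nB n))"
    using assms by (simp_all add: in_phase_A_def y_def)
  note aw = award_B[OF assms(2), folded y_def]
  show le: "coord (x n BallotB) \<le> 1" using aw(3) y(1) coord_le_1_iff by (simp add: y_def)
  have xA: "x (Suc n) BallotA = (1 - \<beta> * y) / (1 - \<alpha>)" using aw(2) y(1) by simp
  have \<beta>y: "(1 - \<beta>) * (\<beta> * y) \<le> \<alpha>"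
    using y(2) \<beta>(1) by (simp add: coord_def field_simps)
  \<comment> \<open>A nonnegative coordinate gives
    \<open>1 - \<beta> * y \<ge> \<zeta> / (1 - \<beta>)\<close>, so A ballots gain positive power
    if \<open>\<zeta> > 0\<close>; this forces the next seat when
    \<open>\<alpha> = \<beta>\<close>.\<close>
  have nonneg: "0 \<le> 1 - \<beta> * y" and pos: "\<zeta> > 0 \<Longrightarrow> 0 < 1 - \<beta> * y"
  proof -
    have "(1 - \<beta>) * (1 - \<beta> * y) \<ge> \<zeta>" using \<beta>y \<zeta>(1) by (simp add: algebra_simps)
    then show "0 \<le> 1 - \<beta> * y" "\<zeta> > 0 \<Longrightarrow> 0 < 1 - \<beta> * y"
      using \<zeta>(2) proportions_less_1(2)
      by (metis diff_gt_0_iff_gt mult_le_cancel_left_pos mult_zero_right order_trans,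
          metis diff_gt_0_iff_gt less_le_trans zero_less_mult_pos)
  qed
  have M: "M (nB n) = int n - (b0 + 2) * int (nB n)"
    using seat_time_seats[of w n PartyB] assms(2) by (simp add: M_def)
  have z: "coord ((1 - \<alpha> * x (Suc n) BallotA) / (1 - \<beta>)) = a * coord y + bstar"
    unfolding xA by (rule coord_award_B_A)
  \<comment> \<open>Here \<open>coord y = W j - M j\<close> for \<open>j = nB n\<close>, and the
    recursion reads \<open>W (Suc j) = a * (W j - M j) + b + M j\<close>.\<close>
  moreover have "a * coord y + bstar
      = W (nB (Suc n)) + of_int b0 * real (nB (Suc n)) - (real (Suc n) + 1 - 2 * real (nB (Suc n)))"
    using assms(2) by (simp add: y(3) seats_Suc M bstar_eq algebra_simps)
  moreover have "0 \<le> a * coord y + bstar" using a_bounds(1) y(2) bstar_nonneg by simp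
  moreover have "a * coord y + bstar \<le> bound"
  proof -
    have "a * coord y \<le> a * 1" using le a_bounds(1) by (intro mult_left_mono) (auto simp: y_def)
    moreover have "0 \<le> W 0" using \<beta> by simp
    ultimately show ?thesis by (simp add: bound_def)
  qed
  ultimately show "in_phase_B (Suc n)"
    using aw(1) nonneg pos unbalanced proportions_less_1(1)
    unfolding in_phase_B_def xA Let_def by auto
qed

text \<open>A second seat for B would need
  \<open>1 - \<beta> \<le> (1 - \<alpha> * u) * (1 - \<alpha>)\<close>, but the right side is at
  most \<open>1 - \<alpha>\<close>, which is at most \<open>1 - \<beta>\<close>, and one of these
  bounds is strict.\<close>

lemma phase_B_award:
  assumes "in_phase_B n"
  shows "w n = PartyA" "in_phase_A (Suc n)"
proof -
  define u where "u = x n BallotA"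
  have u: "x n BallotB = 0" "0 \<le> u" "\<beta> < \<alpha> \<or> 0 < u"
    using assms by (simp_all add: in_phase_B_def u_def)
  show wn: "w n = PartyA"
  proof (rule ccontr)
    assume "w n \<noteq> PartyA"
    then have "w n = PartyB" by (cases "w n") auto
    from award_B(3)[OF this] u(1) have "1 / (1 - \<alpha>) \<le> (1 - \<alpha> * u) / (1 - \<beta>)"
      by (simp add: u_def)
    then have "1 - \<beta> \<le> (1 - \<alpha> * u) * (1 - \<alpha>)"
      using proportions_less_1 by (simp add: divide_simps)
    moreover have "(1 - \<alpha> * u) * (1 - \<alpha>) = (1 - \<alpha>) - \<alpha> * u * (1 - \<alpha>)" by (simp add: algebra_simps)
    moreover have "0 \<le> \<alpha> * u * (1 - \<alpha>)" "0 < u \<Longrightarrow> 0 < \<alpha> * u * (1 - \<alpha>)"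
      using \<beta> u(2) proportions_less_1 by simp_all
    ultimately show False using u(3) \<beta>(2) by linarith
  qed
  show "in_phase_A (Suc n)"
    using assms award_A(1,2)[OF wn] wn
    by (simp add: in_phase_A_def in_phase_B_def Let_def seats_Suc algebra_simps
        del: W.simps)
qed

lemma phases: "in_phase_A n \<or> in_phase_B n"
proof (induction n)
  case 0
  have "0 \<le> W 0" using \<beta> by simp
  then show ?case using a_bounds bstar_nonneg coord_0
    by (simp add: in_phase_A_def bound_def del: W.simps(1))
next
  case (Suc n)
  then show ?case
    using phase_A_award_A phase_A_award_B(1) phase_B_award(2) by (metis party.exhaust)
qed

text \<open>The invariant of phase B describes the coordinate after the coming seat for A, which is
  lower by 1; hence \<open>bound + 1\<close>.\<close>

lemma seat_balance:
  obtains z where "0 \<le> z" "z \<le> bound + 1"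
    "z = W (nB n) + of_int b0 * real (nB n) - (real n - 2 * real (nB n))"
  using phases[of n] that by (force simp: in_phase_A_def in_phase_B_def Let_def)

text \<open>Nonnegativity of \<open>z\<close> in \<open>seat_balance\<close> bounds \<open>n\<close>
  by a function of \<open>nB n\<close>, so \<open>nB\<close> cannot stay bounded.\<close>

lemma seats_B_unbounded: "\<exists>n. nB n > j"
proof (rule ccontr)
  assume "\<nexists>n. nB n > j"
  then have le: "nB n \<le> j" for n by (simp add: not_less)
  define c where "c i = W i + of_int b0 * real i + 2 * real i" for i
  have "real n \<le> Max (c ` {..j})" for n
  proof -
    have "real n \<le> c (nB n)" by (rule seat_balance[of n]) (simp add: c_def)
    also have "\<dots> \<le> Max (c ` {..j})" using le[of n] by (intro Max_ge) auto
    finally show ?thesis .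
  qed
  then show False by (meson linorder_not_le reals_Archimedean2)
qed

lemma seat_time:
  "w (seat_time w PartyB j) = PartyB" "nB (seat_time w PartyB j) = j"
proof -
  obtain n where "nB n > j" using seats_B_unbounded by blast
  then obtain m where "w m = PartyB" "nB m = j" by (rule seats_unbounded_nth)
  with seat_time_seats[of w m PartyB]
  show "w (seat_time w PartyB j) = PartyB" "nB (seat_time w PartyB j) = j" by auto
qed

text \<open>Right before a seat for B the run is in phase A, and its coordinate
  \<open>W j - M j\<close> lies between 0 and 1.\<close>

sublocale mixed_orbit a b W M
proof
  fix j
  define n where "n = seat_time w PartyB j"
  have n: "w n = PartyB" "nB n = j" using seat_time by (simp_all add: n_def)
  have phase: "in_phase_A n" using phases[of n] phase_B_award(1)[of n] n(1) by auto
  have "of_int (M j) = real n - (of_int b0 + 2) * real j" by (simp add: M_def n_def)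
  then have "W j - of_int (M j) = coord (x n BallotB)"
    using phase n(2) by (simp add: in_phase_A_def algebra_simps)
  then show "of_int (M j) \<le> W j" "W j \<le> of_int (M j) + 1"
    using phase phase_A_award_B(2)[OF phase n(1)] unfolding in_phase_A_def by linarith+
qed (use a_bounds in auto)

lemma seats_B_deviation:
  obtains C where "\<And>n. \<bar>real (nB n) - real n * (1 / (2 + of_int b0 + rotation_number a b))\<bar> \<le> C"
proof -
  define \<rho> where "\<rho> = rotation_number a b"
  define s where "s = 2 + of_int b0 + \<rho>"
  have "0 \<le> \<rho>" unfolding \<rho>_def by (rule rotation_number_properties(1)[OF a b_bounds])
  then have s: "s \<ge> 1" using b0_nonneg unfolding s_def by linarith
  have "\<bar>real (nB n) - real n * (1 / s)\<bar> \<le> 3 + \<bar>W 0\<bar> + (bound + 1)" for n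
  proof -
    obtain z where z: "0 \<le> z" "z \<le> bound + 1"
      "z = W (nB n) + of_int b0 * real (nB n) - (real n - 2 * real (nB n))"
      by (rule seat_balance)
    \<comment> \<open>Both terms on the right are bounded, and dividing by \<open>s \<ge> 1\<close>
      preserves the bound.\<close>
    have "real (nB n) * s - real n = z - (W (nB n) - real (nB n) * \<rho>)"
      by (simp add: s_def z(3) algebra_simps)
    then have dev: "\<bar>real (nB n) * s - real n\<bar> \<le> 3 + \<bar>W 0\<bar> + (bound + 1)"
      using deviation_bounded[OF b_bounds, of "nB n"] z(1,2) by (simp add: \<rho>_def)
    have "\<bar>real (nB n) - real n * (1 / s)\<bar> = \<bar>real (nB n) * s - real n\<bar> / s"
    proof -
      have "real (nB n) - real n * (1 / s) = (real (nB n) * s - real n) / s"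
        using s by (simp add: field_simps)
      then show ?thesis using s by simp
    qed
    also have "\<dots> \<le> \<bar>real (nB n) * s - real n\<bar>"
      using s by (simp add: divide_le_eq mult_le_cancel_left1)
    finally show ?thesis using dev by linarith
  qed
  then show thesis unfolding s_def \<rho>_def by (rule that)
qed

text \<open>Periodicity of \<open>M\<close> up to a constant increment means
  \<open>t (j + q) = t j + P\<close> for late seat times of B, and these determine the whole
  sequence.\<close>

lemma eventually_periodic_run:
  assumes "\<zeta> > 0" "rotation_number a b \<in> \<rat>"
  shows "eventually_periodic w"
proof -
  define t where "t = seat_time w PartyB"
  have t: "w (t j) = PartyB" "nB (t j) = j" for j using seat_time by (simp_all add: t_def)
  have t_nB: "t (nB n) = n" if "w n = PartyB" for n
    using seat_time_seats[of w n PartyB] that by (simp add: t_def)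
  obtain N q p where q: "q > 0" and per: "\<And>j. j \<ge> N \<Longrightarrow> M (j + q) = M j + p"
    using rational_imp_eventually_periodic[OF _ b_bounds assms(2)] a_bounds(3) assms(1) by metis
  define P where "P = t (N + q) - t N"
  have less: "t i < t j" if "i < j" for i j
  proof (rule ccontr)
    assume "\<not> t i < t j"
    then have "nB (t j) \<le> nB (t i)" by (intro seats_mono) simp
    then show False using that by (simp add: t)
  qed
  have int_t: "int (t (j + q)) = int (t j) + (p + (b0 + 2) * int q)" if "j \<ge> N" for j
    using per[OF that] by (simp add: M_def t_def algebra_simps)
  have P: "P > 0" "int P = p + (b0 + 2) * int q"
    using less[of N "N + q"] q int_t[of N] by (simp_all add: P_def)
  have t_shift: "t (j + q) = t j + P" if "j \<ge> N" for j
    using int_t[OF that] P(2) by linarith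
  have "w (n + P) = PartyB \<longleftrightarrow> w n = PartyB" if n: "n \<ge> t N" for n
  proof
    assume wn: "w n = PartyB"
    have "nB n \<ge> N" using seats_mono[OF n, of w PartyB] by (simp add: t)
    from t_shift[OF this] show "w (n + P) = PartyB" using t(1)[of "nB n + q"] t_nB[OF wn] by simp
  next
    assume wn: "w (n + P) = PartyB"
    define j where "j = nB (n + P) - q"
    have "N + q \<le> nB (n + P)"
      using seats_mono[of "t (N + q)" "n + P" w PartyB] t_shift[of N] n unfolding t by simp
    then have j: "j \<ge> N" "nB (n + P) = j + q" by (simp_all add: j_def)
    then have "t j + P = n + P" using t_shift[OF j(1)] t_nB[OF wn] by simp
    then show "w n = PartyB" using t(1)[of j] by simp
  qed
  then have "w (n + P) = w n" if "n \<ge> t N" for n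
    using that by (metis party.exhaust)
  with P(1) show ?thesis unfolding eventually_periodic_def by blast
qed

end

section \<open>Collecting the cases and reducing to \<alpha> \<ge> \<beta>\<close>

lemma seats_B_asymptotics:
  fixes \<alpha> \<beta> \<zeta> :: real
  assumes \<beta>: "0 < \<beta>" "\<beta> \<le> \<alpha>" and \<zeta>: "\<zeta> = 1 - \<alpha> - \<beta>" "0 \<le> \<zeta>"
    and run: "phragmen_seats (votes \<alpha> \<beta> \<zeta>) w"
  defines "a \<equiv> \<alpha> * \<beta> / ((1 - \<alpha>) * (1 - \<beta>))"
    and "bstar \<equiv> (\<alpha> - \<beta>) / \<beta> + \<alpha> * (1 - \<alpha> - \<beta>) / ((1 - \<alpha>) * (1 - \<beta>))"
  defines "\<rho> \<equiv> rotation_number a (bstar - of_int \<lfloor>bstar\<rfloor>)"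
  shows "\<exists>C. \<forall>n. \<bar>real (seats w PartyB n) - real n * (1 / (2 + of_int \<lfloor>bstar\<rfloor> + \<rho>))\<bar> \<le> C"
    and "\<rho> \<in> \<rat> \<Longrightarrow> \<zeta> > 0 \<Longrightarrow> eventually_periodic w"
proof -
  interpret phragmen_run \<alpha> \<beta> \<zeta> w
    using \<beta> \<zeta> run by unfold_locales
  have "(\<exists>C. \<forall>n. \<bar>real (seats w PartyB n) - real n * (1 / (2 + of_int \<lfloor>bstar\<rfloor> + \<rho>))\<bar> \<le> C) \<and>
      (\<rho> \<in> \<rat> \<longrightarrow> \<zeta> > 0 \<longrightarrow> eventually_periodic w)"
  proof (cases "\<beta> < \<alpha> \<or> 0 < \<zeta>")
    case True
    then interpret r: unbalanced_run \<alpha> \<beta> \<zeta> w by unfold_locales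
    have "bstar = r.bstar" by (simp add: bstar_def r.bstar_def)
    then have eq: "a = r.a" "bstar - of_int \<lfloor>bstar\<rfloor> = r.b" "\<lfloor>bstar\<rfloor> = r.b0"
      by (simp_all add: a_def r.a_def r.b_def r.b0_def)
    show ?thesis
      using r.seats_B_deviation r.eventually_periodic_run
      unfolding \<rho>_def eq(1,2) unfolding eq(3) by metis
  next
    case False
    \<comment> \<open>Now \<open>a = 1\<close> and the translation is 0, so
      \<open>\<rho> = 0\<close> and the formula gives the share 1/2.\<close>
    then have half: "\<alpha> = 1 / 2" "\<beta> = 1 / 2" "\<zeta> = 0" using \<beta> \<zeta> by auto
    have "bstar = 0" unfolding bstar_def half by simp
    moreover have "a = 1" unfolding a_def half by simp
    ultimately have "\<rho> = 0"
      using rotation_number_properties(1,2)[of 1 0] unfolding \<rho>_def by force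
    then show ?thesis using balanced_deviation[OF half(1,2)] half(3) \<open>bstar = 0\<close>
      by (intro conjI exI[of _ "1 / 2"]) simp_all
  qed
  then show "\<exists>C. \<forall>n. \<bar>real (seats w PartyB n) - real n * (1 / (2 + of_int \<lfloor>bstar\<rfloor> + \<rho>))\<bar> \<le> C"
    and "\<rho> \<in> \<rat> \<Longrightarrow> \<zeta> > 0 \<Longrightarrow> eventually_periodic w" by auto
qed

text \<open>\<open>p\<close> is chosen before \<open>w\<close>, so that the limit does not depend on
  how ties are broken.\<close>

lemma seats_B_linear:
  fixes \<alpha> \<beta> \<zeta> :: real
  assumes "0 \<le> \<beta>" "\<beta> \<le> \<alpha>" "0 < \<alpha>" "\<zeta> = 1 - \<alpha> - \<beta>" "0 \<le> \<zeta>"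
  shows "\<exists>p. \<forall>w. phragmen_seats (votes \<alpha> \<beta> \<zeta>) w \<longrightarrow>
    (\<exists>C. \<forall>n. \<bar>real (seats w PartyB n) - real n * p\<bar> \<le> C)"
proof (cases "\<beta> = 0")
  case True
  have "real (seats w PartyB n) - real n * 0 = 0" if "phragmen_seats (votes \<alpha> \<beta> \<zeta>) w" for w n
    using no_B_ballots_imp_all_A[of \<alpha> \<zeta> w] that True assms by (simp add: seats_def)
  then show ?thesis by (metis abs_zero order_refl)
next
  case False
  then have "0 < \<beta>" using assms(1) by simp
  from seats_B_asymptotics(1)[OF this assms(2,4,5)] show ?thesis by blast
qed

lemma swap_deviation:
  assumes "\<bar>real (seats (swap_party \<circ> w) PartyB n) - real n * p\<bar> \<le> C"
  shows "\<bar>real (seats w PartyB n) - real n * (1 - p)\<bar> \<le> C"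
proof -
  have "real (seats w PartyB n) - real n * (1 - p) = - (real (seats w PartyA n) - real n * p)"
    using seats_add[of w n] by (simp add: algebra_simps flip: of_nat_add)
  then show ?thesis using assms by (simp add: seats_swap)
qed

theorem theorem1p2:
  fixes \<alpha> \<beta> \<zeta> :: real
  assumes "\<alpha> \<ge> 0" and "\<beta> \<ge> 0" and "\<zeta> = 1 - \<alpha> - \<beta>" and "\<zeta> \<ge> 0"
    and "\<alpha> + \<beta> > 0"
  defines "a \<equiv> \<alpha> * \<beta> / ((\<alpha> + \<zeta>) * (\<beta> + \<zeta>))"
    and "bstar \<equiv> (\<alpha> - \<beta>) / \<beta> + \<alpha> * (1 - \<alpha> - \<beta>) / ((1 - \<alpha>) * (1 - \<beta>))"
  defines "b \<equiv> bstar - of_int \<lfloor>bstar\<rfloor>"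
    and "b0 \<equiv> \<lfloor>bstar\<rfloor>"
  defines "\<rho> \<equiv> rotation_number a b"
  shows "\<exists>p\<^sub>A p\<^sub>B :: real. p\<^sub>B = 1 - p\<^sub>A \<and>
    (\<forall>w. phragmen_seats (votes \<alpha> \<beta> \<zeta>) w \<longrightarrow>
      (\<lambda>n. real (seats w PartyA n) / real n) \<longlonglongrightarrow> p\<^sub>A \<and>
      (\<lambda>n. real (seats w PartyB n) / real n) \<longlonglongrightarrow> p\<^sub>B \<and>
      (\<lambda>n. real (seats w PartyA n) - p\<^sub>A * real n) \<in> O(\<lambda>_. 1) \<and>
      (\<lambda>n. real (seats w PartyB n) - p\<^sub>B * real n) \<in> O(\<lambda>_. 1)) \<and>
    (\<alpha> \<ge> \<beta> \<and> \<beta> > 0 \<longrightarrow>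
      p\<^sub>B = 1 / (2 + of_int b0 + \<rho>) \<and>
      a = \<alpha> * \<beta> / ((1 - \<alpha>) * (1 - \<beta>)) \<and> 0 < a \<and> a \<le> 1 \<and>
      (a < 1 \<longleftrightarrow> \<zeta> > 0)) \<and>
    (\<alpha> \<ge> \<beta> \<and> \<beta> > 0 \<and> \<rho> \<in> \<rat> \<and> \<zeta> > 0 \<longrightarrow>
      (\<forall>w. phragmen_seats (votes \<alpha> \<beta> \<zeta>) w \<longrightarrow> eventually_periodic w))"
proof (cases "\<beta> \<le> \<alpha> \<and> 0 < \<beta>")
  case True
  have a: "a = \<alpha> * \<beta> / ((1 - \<alpha>) * (1 - \<beta>))"
    using assms(3) by (simp add: a_def mult.commute)
  note bounds = contraction_ratio_bounds[OF conjunct2[OF True] conjunct1[OF True] assms(3,4)]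
  define p where "p = 1 / (2 + of_int b0 + \<rho>)"
  have asym: "\<exists>C. \<forall>n. \<bar>real (seats w PartyB n) - real n * p\<bar> \<le> C"
    "\<rho> \<in> \<rat> \<Longrightarrow> \<zeta> > 0 \<Longrightarrow> eventually_periodic w"
    if "phragmen_seats (votes \<alpha> \<beta> \<zeta>) w" for w
    using seats_B_asymptotics[OF _ _ assms(3,4) that] True
    unfolding p_def \<rho>_def b_def b0_def bstar_def a by auto
  show ?thesis
  proof (rule exI[of _ "1 - p"], rule exI[of _ p], intro conjI allI impI)
    fix w assume "phragmen_seats (votes \<alpha> \<beta> \<zeta>) w"
    from asym(1)[OF this] obtain C where "\<And>n. \<bar>real (seats w PartyB n) - real n * p\<bar> \<le> C" by blast
    note seats_asymptotics[OF this]
    then show "(\<lambda>n. real (seats w PartyA n) / real n) \<longlonglongrightarrow> 1 - p"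
      "(\<lambda>n. real (seats w PartyB n) / real n) \<longlonglongrightarrow> p"
      "(\<lambda>n. real (seats w PartyA n) - (1 - p) * real n) \<in> O(\<lambda>_. 1)"
      "(\<lambda>n. real (seats w PartyB n) - p * real n) \<in> O(\<lambda>_. 1)" by blast+
  qed (use asym(2) bounds in \<open>auto simp: p_def a\<close>)
next
  case False
  \<comment> \<open>Only the limits are at stake here: either \<open>\<beta> = 0\<close>, or
    \<open>\<alpha> < \<beta>\<close> and the parties are exchanged.\<close>
  have "\<exists>p. \<forall>w. phragmen_seats (votes \<alpha> \<beta> \<zeta>) w \<longrightarrow>
    (\<exists>C. \<forall>n. \<bar>real (seats w PartyB n) - real n * p\<bar> \<le> C)"
  proof (cases "\<beta> \<le> \<alpha>")
    case True
    then show ?thesis using assms by (intro seats_B_linear) auto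
  next
    case False
    then obtain p where "\<And>w. phragmen_seats (votes \<beta> \<alpha> \<zeta>) w \<Longrightarrow>
        \<exists>C. \<forall>n. \<bar>real (seats w PartyB n) - real n * p\<bar> \<le> C"
      using seats_B_linear[of \<alpha> \<beta> \<zeta>] assms by auto
    then have "\<exists>C. \<forall>n. \<bar>real (seats w PartyB n) - real n * (1 - p)\<bar> \<le> C"
      if "phragmen_seats (votes \<alpha> \<beta> \<zeta>) w" for w
      using phragmen_seats_swap[OF that] swap_deviation by meson
    then show ?thesis by blast
  qed
  then obtain p where p: "\<And>w. phragmen_seats (votes \<alpha> \<beta> \<zeta>) w \<Longrightarrow>
    \<exists>C. \<forall>n. \<bar>real (seats w PartyB n) - real n * p\<bar> \<le> C" by blast
  show ?thesis
  proof (rule exI[of _ "1 - p"], rule exI[of _ p], intro conjI allI impI)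
    fix w assume "phragmen_seats (votes \<alpha> \<beta> \<zeta>) w"
    from p[OF this] obtain C where "\<And>n. \<bar>real (seats w PartyB n) - real n * p\<bar> \<le> C" by blast
    note seats_asymptotics[OF this]
    then show "(\<lambda>n. real (seats w PartyA n) / real n) \<longlonglongrightarrow> 1 - p"
      "(\<lambda>n. real (seats w PartyB n) / real n) \<longlonglongrightarrow> p"
      "(\<lambda>n. real (seats w PartyA n) - (1 - p) * real n) \<in> O(\<lambda>_. 1)"
      "(\<lambda>n. real (seats w PartyB n) - p * real n) \<in> O(\<lambda>_. 1)" by blast+
  qed (use False in auto)
qed

end
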